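(* Let $t=t(\varepsilon)$ be a positive function (a time scale). Suppose that the semi-Markov process $X_t^{x,\varepsilon}$ described below satisfies assumptions (a)–(f) listed below, and that for some $1<M'<M$ the states $\{1,\dots,M'\}$ form one ergodic class with respect to the limiting transition probabilities $P_{ij}^0=\lim_{\varepsilon\downarrow 0}P_{ij}^{\varepsilon}$. Let $E=\{1\le i\le M' : \tau_i^{\varepsilon}\ll t(\varepsilon)\}$ and $E'=\{1\le i\le M' : \tau_i^{\varepsilon}\gg t(\varepsilon)\}$. If $E,E'\neq\emptyset$ and $E\cup E'=\{1,\dots,M'\}$, then for each $i\in E$ there is a probability measure $\mu(i,\cdot)$ concentrated on $E'$ such that $$\lim_{\varepsilon\downarrow 0}\mathbb P\left(X^{x,\varepsilon}_{t(\varepsilon)}\in S_j\right)=\mu(i,j)$$ uniformly in $x\in S_i$. Moreover, if $t_1(\varepsilon)\le t_2(\varepsilon)$ are two time scales associated with the same sets $E$ and $E'$ (i.e., defining $E,E'$ via $t_1$ or via $t_2$ gives the same sets), then the limit holds uniformly in all time scales $t(\varepsilon)$ satisfying $t_1(\varepsilon)\le t(\varepsilon)\le t_2(\varepsilon)$.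
   Context: Notation: for $f,g:(0,\infty)\to[0,\infty)$, $f(\varepsilon)\ll g(\varepsilon)$ means $\lim_{\varepsilon\downarrow0}f(\varepsilon)/g(\varepsilon)=0$; $f\gg g$ means $g\ll f$. Setting: $S=S_1\cup\dots\cup S_M$ is a metric space decomposed into disjoint measurable sets. For each $\varepsilon>0$, $Q^{\varepsilon}:S\times\mathcal B(S\times[0,\infty))\to[0,1]$ is a Markov transition kernel; for $x\in S$, $({\bf X}_n^{x,\varepsilon},{\bf T}_n^{x,\varepsilon})$ is the Markov chain with kernel $Q^\varepsilon$ and $({\bf X}_0^{x,\varepsilon},{\bf T}_0^{x,\varepsilon})=(x,0)$, and the semi-Markov process is $X_t^{x,\varepsilon}={\bf X}_n^{x,\varepsilon}$ for $\sum_{m=0}^n{\bf T}_m^{x,\varepsilon}\le t<\sum_{m=0}^{n+1}{\bf T}_m^{x,\varepsilon}$. Write $P^\varepsilon(x,B)=Q^\varepsilon(x,B\times[0,\infty))$, and, when $P^\varepsilon(x,B)>0$, let $T^\varepsilon(x,B)$ be a random variable with $\mathbb P(T^\varepsilon(x,B)\le t)=\mathbb P({\bf T}_1^{x,\varepsilon}\le t\mid {\bf X}_1^{x,\varepsilon}\in B)$. Assumptions: (a) $P^\varepsilon(x,S_i)=0$ for $x\in S_i$; for $i\ne j$, $P^\varepsilon(x,S_j)$ is either identically $0$ for $x\in S_i$ or positive for all $x\in S_i,\varepsilon>0$, and in the latter case there are functions $P^\varepsilon_{ij}$ with $P^\varepsilon(x,S_j)/P^\varepsilon_{ij}\to1$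 uniformly in $x\in S_i$ (otherwise $P^\varepsilon_{ij}\equiv0$); $\sum_{j\ne i}P^\varepsilon_{ij}=1$; and for every $i\ne j$ there is a sequence $i=i_1,\dots,i_k=j$ with $P^\varepsilon_{i_ri_{r+1}}>0$ for all $\varepsilon>0$. (b) For each $i$ there is a function $\tau_i^\varepsilon$ with $\mathbb E\,T^\varepsilon(x,S_j)/\tau_i^\varepsilon\to1$ uniformly in $x\in S_i$ for every $j$ with $P^\varepsilon_{ij}\not\equiv0$. (c) There are $C,\varepsilon_0>0$ with $\mathrm{Var}\,T^\varepsilon(x,S_j)\le C(\tau_i^\varepsilon)^2$ for $\varepsilon\le\varepsilon_0$, $x\in S_i$, whenever $P^\varepsilon_{ij}\not\equiv0$. (d) For every bounded continuous $f:[0,\infty)\to\mathbb R$, $\mathbb E\big(f(T^\varepsilon(x_1,S_{j_1})/\tau_i^\varepsilon)-f(T^\varepsilon(x_2,S_{j_2})/\tau_i^\varepsilon)\big)\to0$ uniformly in $x_1,x_2\in S_i$ when $P^\varepsilon_{ij_1},P^\varepsilon_{ij_2}$ are positive. (e) If $x_n\in S_i$, $\varepsilon_n\downarrow0$ and $T^{\varepsilon_n}(x_n,S_j)/\tau_i^{\varepsilon_n}\to\xi$ in distribution, then $\xi$ has no atoms. (f) (complete asymptotic regularity) $\lim_{\varepsilon\downarrow0}\frac{P^\varepsilon_{a_1b_1}}{P^\varepsilon_{a_1d_1}}\cdots\frac{P^\varepsilon_{a_rb_r}}{P^\varepsilon_{a_rd_r}}\cdot\frac{\tau_a^\varepsilon}{\tau_c^\varepsilon}\in[0,\infty]$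 exists for all indices with $a_i\ne b_i$, $a_i\ne d_i$ for which the quantities are defined. These ensure the limits $P^0_{ij}$ exist. No rescaling of time is performed. *)

theory Defs
  imports "HOL-Probability.Probability"
begin

text \<open>State space: a metric space of type 'a with its Borel sigma-algebra.
  The transition kernel is Q eps x, a probability measure on
  (state, holding time) pairs, i.e. on the product space of borel and borel
  on 'a times real (holding times are a.s. nonnegative, see the theorem).\<close>

abbreviation SP :: "('a::metric_space \<times> real) measure" where
  "SP \<equiv> borel \<Otimes>\<^sub>M borel"

text \<open>P eps x B = Q eps x (B times [0,inf)).\<close>
definition Pk :: "(real \<Rightarrow> 'a::metric_space \<Rightarrow> ('a \<times> real) measure) \<Rightarrow> real \<Rightarrow> 'a \<Rightarrow> 'a set \<Rightarrow> real" where
  "Pk Q eps x B = measure (Q eps x) (B \<times> UNIV)"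

text \<open>Law of T eps (x,B): law of the first holding time conditioned on X_1 in B.\<close>
definition condT :: "(real \<Rightarrow> 'a::metric_space \<Rightarrow> ('a \<times> real) measure) \<Rightarrow> real \<Rightarrow> 'a \<Rightarrow> 'a set \<Rightarrow> real measure" where
  "condT Q eps x B = distr (uniform_measure (Q eps x) (B \<times> UNIV)) borel snd"

text \<open>Joint law of (X_n, S_n) where S_n = T_1 + ... + T_n is the time of the n-th jump
  of the Markov chain (X_n,T_n) with kernel Q eps started at (x,0).\<close>
fun chainXS :: "(real \<Rightarrow> 'a::metric_space \<Rightarrow> ('a \<times> real) measure) \<Rightarrow> real \<Rightarrow> 'a \<Rightarrow> nat \<Rightarrow> ('a \<times> real) measure" where
  "chainXS Q eps x 0 = return SP (x, 0)"
| "chainXS Q eps x (Suc n) =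
     chainXS Q eps x n \<bind> (\<lambda>(y, s). distr (Q eps y) SP (\<lambda>(z, \<tau>). (z, s + \<tau>)))"

text \<open>Joint law of (X_n, S_n, S_{n+1}).\<close>
definition chainXSS :: "(real \<Rightarrow> 'a::metric_space \<Rightarrow> ('a \<times> real) measure) \<Rightarrow> real \<Rightarrow> 'a \<Rightarrow> nat \<Rightarrow> ('a \<times> real \<times> real) measure" where
  "chainXSS Q eps x n =
     chainXS Q eps x n \<bind> (\<lambda>(y, s). distr (Q eps y) (borel \<Otimes>\<^sub>M (borel \<Otimes>\<^sub>M borel)) (\<lambda>(z, \<tau>). (y, s, s + \<tau>)))"

text \<open>P(X^{x,eps}_t in B) for the semi-Markov process X_t = X_n for S_n \<le> t < S_{n+1}:
  the events {X_n in B, S_n \<le> t < S_{n+1}} (n = 0,1,...) are disjoint, so the probability is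
  the sum of their probabilities.\<close>
definition semiMarkovProb :: "(real \<Rightarrow> 'a::metric_space \<Rightarrow> ('a \<times> real) measure) \<Rightarrow> real \<Rightarrow> 'a \<Rightarrow> real \<Rightarrow> 'a set \<Rightarrow> real" where
  "semiMarkovProb Q eps x t B =
     enn2real (\<Sum>n. emeasure (chainXSS Q eps x n) {(y, s, s'). y \<in> B \<and> s \<le> t \<and> t < s'})"

text \<open>Limiting transition probabilities P^0_{ij}.\<close>
definition P0 :: "(nat \<Rightarrow> nat \<Rightarrow> real \<Rightarrow> real) \<Rightarrow> nat \<Rightarrow> nat \<Rightarrow> real" where
  "P0 Pij i j = Lim (at_right 0) (Pij i j)"

text \<open>C is an ergodic class (closed communicating class) of the finite Markov chain on
  {1..M} with transition matrix P.\<close>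
definition ergodic_class :: "(nat \<Rightarrow> nat \<Rightarrow> real) \<Rightarrow> nat \<Rightarrow> nat set \<Rightarrow> bool" where
  "ergodic_class P M C \<longleftrightarrow>
     C \<noteq> {} \<and> C \<subseteq> {1..M} \<and>
     (\<forall>i\<in>C. \<forall>j\<in>{1..M}. j \<notin> C \<longrightarrow> P i j = 0) \<and>
     (\<forall>i\<in>C. \<forall>j\<in>C. (i, j) \<in> {(a, b). a \<in> {1..M} \<and> b \<in> {1..M} \<and> P a b > 0}\<^sup>*)"

text \<open>f \<ll> g as eps decreases to 0.\<close>
definition llt :: "(real \<Rightarrow> real) \<Rightarrow> (real \<Rightarrow> real) \<Rightarrow> bool" where
  "llt f g \<longleftrightarrow> ((\<lambda>e. f e / g e) \<longlongrightarrow> 0) (at_right 0)"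

text \<open>P^eps(x,S_j) > 0 for all x in S_i and eps > 0 (equivalently P^eps_{ij} not identically 0).\<close>
definition posTrans :: "(real \<Rightarrow> 'a::metric_space \<Rightarrow> ('a \<times> real) measure) \<Rightarrow> (nat \<Rightarrow> 'a set) \<Rightarrow> nat \<Rightarrow> nat \<Rightarrow> bool" where
  "posTrans Q S i j \<longleftrightarrow> (\<forall>eps>0. \<forall>x\<in>S i. Pk Q eps x (S j) > 0)"

text \<open>E = {1 \<le> i \<le> M' : tau_i \<ll> t} and E' = {1 \<le> i \<le> M' : tau_i \<gg> t}.\<close>
definition fastSet :: "(nat \<Rightarrow> real \<Rightarrow> real) \<Rightarrow> (real \<Rightarrow> real) \<Rightarrow> nat \<Rightarrow> nat set" where
  "fastSet tau t M' = {i \<in> {1..M'}. llt (tau i) t}"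

definition slowSet :: "(nat \<Rightarrow> real \<Rightarrow> real) \<Rightarrow> (real \<Rightarrow> real) \<Rightarrow> nat \<Rightarrow> nat set" where
  "slowSet tau t M' = {i \<in> {1..M'}. llt t (tau i)}"

end

theory Submission
  imports Defs
begin

text \<open>
  Let \<open>F\<^sub>j(x, t)\<close> be the probability of being in \<open>S\<^sub>j\<close> at time \<open>t\<close>. Conditioning on the first jump gives
  the renewal equation \<open>F\<^sub>j(x, t) = 1\<^bsub>x \<in> S\<^sub>j\<^esub> \<cdot> P(T\<^sub>1 > t) + E(F\<^sub>j(X\<^sub>1, t - T\<^sub>1))\<close>. Sojourns in \<open>E\<close> are negligible
  compared with \<open>t\<close> (Markov's inequality) and a sojourn in \<open>E'\<close> outlasts \<open>t\<close> (tightness and the absence of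
  an atom at \<open>0\<close>). By induction on \<open>n\<close>, \<open>F\<^sub>j(x, t)\<close> is therefore asymptotically at least the probability that
  the limiting chain \<open>P\<^sup>0\<close> started at \<open>i\<close> enters \<open>E'\<close> within \<open>n\<close> steps, and first at \<open>j\<close>; here the lower end
  \<open>c t\<^sub>1\<close> of the time window is halved in each step. As \<open>n\<close> grows these probabilities increase to the
  hitting distribution \<open>\<mu>(i, j)\<close>, which has total mass one by irreducibility and the minimum principle.
  Since \<open>\<Sum>\<^sub>j F\<^sub>j \<le> 1\<close>, the lower bounds force the matching upper bounds.
\<close>

section \<open>The renewal equation\<close>

text \<open>The probability that sojourn number \<open>n\<close>, counted from 0, covers time
  \<open>t\<close> and is spent in \<open>B\<close>. The recursion removes the first jump, whereas
  \<open>chainXS\<close> appends the last one; this is the direction that leads to a renewal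
  equation. Values in \<open>ennreal\<close> avoid all questions of integrability.\<close>

primrec occ :: "('a::metric_space \<Rightarrow> ('a \<times> real) measure) \<Rightarrow> 'a set \<Rightarrow> nat \<Rightarrow> 'a \<Rightarrow> real \<Rightarrow> ennreal" where
  "occ K B 0 x t = indicator B x * indicator {0..} t * (\<integral>\<^sup>+p. indicator {t<..} (snd p) \<partial>K x)"
| "occ K B (Suc n) x t = (\<integral>\<^sup>+p. occ K B n (fst p) (t - snd p) \<partial>K x)"

context
  fixes K :: "'a::metric_space \<Rightarrow> ('a \<times> real) measure"
  assumes K: "K \<in> borel \<rightarrow>\<^sub>M prob_algebra SP"
begin

lemma kernel_prob_space: "prob_space (K x)" and sets_kernel: "sets (K x) = sets SP"
  using measurable_space[OF K, of x] by (auto simp: space_prob_algebra)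

lemma space_kernel: "space (K x) = UNIV"
  using sets_eq_imp_space_eq[OF sets_kernel] by (simp add: space_pair_measure)

lemma kernel_subprob: "K \<in> borel \<rightarrow>\<^sub>M subprob_algebra SP"
  using K by (rule measurable_prob_algebraD)

lemma measurable_occ:
  assumes B: "B \<in> sets borel"
  shows "(\<lambda>(x, t). occ K B n x t) \<in> borel_measurable SP"
proof (induction n)
  case 0
  have [measurable]: "B \<in> sets borel" by fact
  have L: "(\<lambda>q. K (fst q)) \<in> SP \<rightarrow>\<^sub>M subprob_algebra SP"
    using kernel_subprob by measurable
  \<comment> \<open>The moving set \<open>{snd q<..}\<close> is replaced by a comparison of two
    measurable functions, which exhibits the integrand as jointly measurable in \<open>q\<close> and
    \<open>p\<close>.\<close>
  have "(\<lambda>q. \<integral>\<^sup>+p. (if snd q < snd p then 1 else 0) \<partial>K (fst q)) \<in> borel_measurable (SP :: ('a \<times> real) measure)"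
    by (rule nn_integral_measurable_subprob_algebra2[OF _ L]) measurable
  then have [measurable]: "(\<lambda>q. \<integral>\<^sup>+p. indicator {snd q<..} (snd p) \<partial>K (fst q)) \<in> borel_measurable (SP :: ('a \<times> real) measure)"
    by (simp add: indicator_def of_bool_def)
  show ?case unfolding case_prod_beta occ.simps by measurable
next
  case (Suc n)
  have L: "(\<lambda>q. K (fst q)) \<in> SP \<rightarrow>\<^sub>M subprob_algebra SP"
    using kernel_subprob by measurable
  have 1: "(\<lambda>(q, p). occ K B n (fst p) (snd q - snd p)) \<in> borel_measurable ((SP :: ('a \<times> real) measure) \<Otimes>\<^sub>M SP)"
  proof -
    have "(\<lambda>r. (fst (snd r), snd (fst r) - snd (snd r))) \<in> (SP :: ('a \<times> real) measure) \<Otimes>\<^sub>M SP \<rightarrow>\<^sub>M SP"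
      by measurable
    from measurable_compose[OF this Suc] show ?thesis by (simp add: case_prod_beta)
  qed
  show ?case unfolding case_prod_beta occ.simps
    using nn_integral_measurable_subprob_algebra2[OF 1 L] by (simp add: case_prod_beta)
qed

lemma measurable_shift_kernel:
  "(\<lambda>q. distr (K (fst q)) SP (\<lambda>p. (fst p, snd q + snd p))) \<in> SP \<rightarrow>\<^sub>M subprob_algebra SP"
proof -
  have "(\<lambda>(q::'a \<times> real, p). (fst p, snd q + snd p)) \<in> SP \<Otimes>\<^sub>M SP \<rightarrow>\<^sub>M (SP :: ('a \<times> real) measure)"
    by measurable
  moreover have "(\<lambda>q. K (fst q)) \<in> SP \<rightarrow>\<^sub>M subprob_algebra SP"
    using kernel_subprob by measurable
  ultimately show ?thesis
    by (rule measurable_distr2)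
qed

lemma measurable_jump_kernel:
  "(\<lambda>q. distr (K (fst q)) (borel \<Otimes>\<^sub>M (borel \<Otimes>\<^sub>M borel)) (\<lambda>p. (fst q, snd q, snd q + snd p)))
    \<in> SP \<rightarrow>\<^sub>M subprob_algebra (borel \<Otimes>\<^sub>M (borel \<Otimes>\<^sub>M borel))"
proof -
  have "(\<lambda>(q::'a \<times> real, p). (fst q, snd q, snd q + snd p)) \<in> SP \<Otimes>\<^sub>M SP \<rightarrow>\<^sub>M (borel \<Otimes>\<^sub>M (borel \<Otimes>\<^sub>M borel))"
    by measurable
  moreover have "(\<lambda>q. K (fst q)) \<in> SP \<rightarrow>\<^sub>M subprob_algebra SP"
    using kernel_subprob by measurable
  ultimately show ?thesis
    by (rule measurable_distr2)
qed

end

section \<open>The semi-Markov probabilities as a series of sojourn probabilities\<close>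

lemma chainXS_Suc':
  "chainXS Q eps x (Suc n) =
    chainXS Q eps x n \<bind> (\<lambda>q. distr (Q eps (fst q)) SP (\<lambda>p. (fst p, snd q + snd p)))"
  by (simp add: case_prod_beta')

lemma chainXSS_eq:
  "chainXSS Q eps x n =
    chainXS Q eps x n \<bind> (\<lambda>q. distr (Q eps (fst q)) (borel \<Otimes>\<^sub>M (borel \<Otimes>\<^sub>M borel)) (\<lambda>p. (fst q, snd q, snd q + snd p)))"
  by (simp add: chainXSS_def case_prod_beta')

context
  fixes Q :: "real \<Rightarrow> 'a::metric_space \<Rightarrow> ('a \<times> real) measure" and eps :: real
  assumes K: "Q eps \<in> borel \<rightarrow>\<^sub>M prob_algebra SP"
begin

lemma sets_chainXS: "sets (chainXS Q eps x n) = sets SP"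
proof (induction n)
  case (Suc n)
  then have "space (chainXS Q eps x n) \<noteq> {}"
    using sets_eq_imp_space_eq[OF Suc] by (simp add: space_pair_measure)
  then show ?case
    unfolding chainXS_Suc' by (subst sets_bind) auto
qed simp

lemma space_chainXS: "space (chainXS Q eps x n) = UNIV"
  using sets_eq_imp_space_eq[OF sets_chainXS] by (simp add: space_pair_measure)

text \<open>A Chapman-Kolmogorov identity that reconciles the two recursions: the last jump of the
  chain becomes the first jump seen by \<open>occ\<close>. Hence \<open>k\<close> has to vary in the
  induction on \<open>n\<close>, growing as \<open>n\<close> shrinks.\<close>

lemma nn_integral_chainXS_occ:
  assumes B: "B \<in> sets borel"
  shows "(\<integral>\<^sup>+q. occ (Q eps) B k (fst q) (t - snd q) \<partial>chainXS Q eps x n) = occ (Q eps) B (n + k) x t"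
proof (induction n arbitrary: k)
  case 0
  have m: "(\<lambda>q. occ (Q eps) B k (fst q) (t - snd q)) \<in> borel_measurable SP"
  proof -
    have "(\<lambda>q. (fst q, t - snd q)) \<in> (SP :: ('a \<times> real) measure) \<rightarrow>\<^sub>M SP" by measurable
    from measurable_compose[OF this measurable_occ[OF K B]] show ?thesis by simp
  qed
  show ?case by (simp add: nn_integral_return[OF _ m] space_pair_measure)
next
  case (Suc n)
  have m: "(\<lambda>q. occ (Q eps) B k (fst q) (t - snd q)) \<in> borel_measurable SP"
  proof -
    have "(\<lambda>q. (fst q, t - snd q)) \<in> (SP :: ('a \<times> real) measure) \<rightarrow>\<^sub>M SP" by measurable
    from measurable_compose[OF this measurable_occ[OF K B]] show ?thesis by simp
  qed
  have mk: "(\<lambda>q. distr (Q eps (fst q)) SP (\<lambda>p. (fst p, snd q + snd p)))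
      \<in> chainXS Q eps x n \<rightarrow>\<^sub>M subprob_algebra SP"
    unfolding measurable_cong_sets[OF sets_chainXS refl] by (rule measurable_shift_kernel[OF K])
  have "(\<integral>\<^sup>+q. occ (Q eps) B k (fst q) (t - snd q) \<partial>chainXS Q eps x (Suc n)) =
     (\<integral>\<^sup>+q. \<integral>\<^sup>+r. occ (Q eps) B k (fst r) (t - snd r) \<partial>distr (Q eps (fst q)) SP (\<lambda>p. (fst p, snd q + snd p)) \<partial>chainXS Q eps x n)"
    unfolding chainXS_Suc' by (rule nn_integral_bind[OF m mk])
  also have "\<dots> = (\<integral>\<^sup>+q. occ (Q eps) B (Suc k) (fst q) (t - snd q) \<partial>chainXS Q eps x n)"
  proof (rule nn_integral_cong)
    fix q :: "'a \<times> real"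
    have "(\<lambda>p. (fst p, snd q + snd p)) \<in> (SP :: ('a \<times> real) measure) \<rightarrow>\<^sub>M SP" by measurable
    then have "(\<lambda>p. (fst p, snd q + snd p)) \<in> Q eps (fst q) \<rightarrow>\<^sub>M SP"
      unfolding measurable_cong_sets[OF sets_kernel[OF K] refl] .
    from nn_integral_distr[OF this, of "\<lambda>q. occ (Q eps) B k (fst q) (t - snd q)"] m show "(\<integral>\<^sup>+r. occ (Q eps) B k (fst r) (t - snd r) \<partial>distr (Q eps (fst q)) SP (\<lambda>p. (fst p, snd q + snd p))) =
      occ (Q eps) B (Suc k) (fst q) (t - snd q)"
      by (simp add: algebra_simps)
  qed
  also have "\<dots> = occ (Q eps) B (Suc n + k) x t"
    using Suc[of "Suc k"] by simp
  finally show ?case .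
qed

text \<open>Given the state and time of jump \<open>n\<close>, the event is that of sojourn 0 at the
  residual time \<open>t - snd q\<close>; averaging over the chain is the preceding identity with
  \<open>k = 0\<close>.\<close>

lemma emeasure_chainXSS:
  assumes B: "B \<in> sets borel"
  shows "emeasure (chainXSS Q eps x n) {(y, s, s'). y \<in> B \<and> s \<le> t \<and> t < s'} = occ (Q eps) B n x t"
proof -
  let ?A = "{(y, s, s'). y \<in> B \<and> s \<le> t \<and> t < s'}"
  let ?N = "borel \<Otimes>\<^sub>M (borel \<Otimes>\<^sub>M borel) :: ('a \<times> real \<times> real) measure"
  have "?A = B \<times> ({..t} \<times> {t<..})" by auto
  then have A: "?A \<in> sets ?N" using B by auto
  have mk: "(\<lambda>q. distr (Q eps (fst q)) ?N (\<lambda>p. (fst q, snd q, snd q + snd p)))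
      \<in> chainXS Q eps x n \<rightarrow>\<^sub>M subprob_algebra ?N"
    unfolding measurable_cong_sets[OF sets_chainXS refl] by (rule measurable_jump_kernel[OF K])
  have "emeasure (chainXSS Q eps x n) ?A =
     (\<integral>\<^sup>+q. emeasure (distr (Q eps (fst q)) ?N (\<lambda>p. (fst q, snd q, snd q + snd p))) ?A \<partial>chainXS Q eps x n)"
    unfolding chainXSS_eq by (rule emeasure_bind[OF _ mk A]) (simp add: space_chainXS)
  also have "\<dots> = (\<integral>\<^sup>+q. occ (Q eps) B 0 (fst q) (t - snd q) \<partial>chainXS Q eps x n)"
  proof (rule nn_integral_cong)
    fix q :: "'a \<times> real"
    have "(\<lambda>p. (fst q, snd q, snd q + snd p)) \<in> (SP :: ('a \<times> real) measure) \<rightarrow>\<^sub>M ?N" by measurable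
    then have m: "(\<lambda>p. (fst q, snd q, snd q + snd p)) \<in> Q eps (fst q) \<rightarrow>\<^sub>M ?N"
      unfolding measurable_cong_sets[OF sets_kernel[OF K] refl] .
    have "emeasure (distr (Q eps (fst q)) ?N (\<lambda>p. (fst q, snd q, snd q + snd p))) ?A =
        (\<integral>\<^sup>+p. indicator ?A p \<partial>distr (Q eps (fst q)) ?N (\<lambda>p. (fst q, snd q, snd q + snd p)))"
      using A by simp
    also have "\<dots> = (\<integral>\<^sup>+p. indicator ?A (fst q, snd q, snd q + snd p) \<partial>Q eps (fst q))"
      by (rule nn_integral_distr[OF m]) (use A in simp)
    also have "\<dots> = (\<integral>\<^sup>+p. indicator B (fst q) * indicator {0..} (t - snd q) * indicator {t - snd q<..} (snd p) \<partial>Q eps (fst q))"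
      by (rule nn_integral_cong) (auto split: split_indicator)
    also have "\<dots> = occ (Q eps) B 0 (fst q) (t - snd q)"
    proof -
      have "(\<lambda>p. indicator {t - snd q<..} (snd p) :: ennreal) \<in> borel_measurable (SP :: ('a \<times> real) measure)" by measurable
      then have "(\<lambda>p. indicator {t - snd q<..} (snd p) :: ennreal) \<in> borel_measurable (Q eps (fst q))"
        unfolding measurable_cong_sets[OF sets_kernel[OF K] refl] .
      then show ?thesis by (simp add: nn_integral_cmult)
    qed
    finally show "emeasure (distr (Q eps (fst q)) ?N (\<lambda>p. (fst q, snd q, snd q + snd p))) ?A = occ (Q eps) B 0 (fst q) (t - snd q)" .
  qed
  also have "\<dots> = occ (Q eps) B n x t"
    using nn_integral_chainXS_occ[OF B, where k = 0] by simp
  finally show ?thesis .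
qed

lemma semiMarkovProb_eq:
  "B \<in> sets borel \<Longrightarrow> semiMarkovProb Q eps x t B = enn2real (\<Sum>n. occ (Q eps) B n x t)"
  unfolding semiMarkovProb_def by (simp only: emeasure_chainXSS)

section \<open>Total mass and one-step estimates for nonnegative holding times\<close>

context
  assumes nonneg: "\<And>x. emeasure (Q eps x) (UNIV \<times> {..<0}) = 0"
begin

lemma AE_time_nonneg: "AE p in Q eps x. 0 \<le> snd p"
proof (rule AE_I)
  show "{p \<in> space (Q eps x). \<not> 0 \<le> snd p} \<subseteq> UNIV \<times> {..<0}" by auto
  show "UNIV \<times> {..<0} \<in> sets (Q eps x)" unfolding sets_kernel[OF K]
    by (rule pair_measureI) auto
qed (rule nonneg)

lemma measurable_occ_shift:
  assumes B: "B \<in> sets borel"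
  shows "(\<lambda>p. occ (Q eps) B n (fst p) (t - snd p)) \<in> borel_measurable (Q eps x)"
proof -
  have "(\<lambda>q. (fst q, t - snd q)) \<in> (SP :: ('a \<times> real) measure) \<rightarrow>\<^sub>M SP" by measurable
  from measurable_compose[OF this measurable_occ[OF K B]] show ?thesis
    unfolding measurable_cong_sets[OF sets_kernel[OF K] refl] by simp
qed

text \<open>At any time at most one sojourn is in progress. Without a path space this comes from the
  first jump: either it is later than \<open>t\<close>, or the induction hypothesis bounds the rest
  at the residual time. The indicator on the right, in place of 1, lets the two cases add up to
  one.\<close>

lemma sum_occ_le: "(\<Sum>n<N. occ (Q eps) UNIV n x t) \<le> indicator {0..} t"
proof (induction N arbitrary: x t)
  case (Suc N)
  interpret prob_space "Q eps x" by (rule kernel_prob_space[OF K])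
  have m1: "(\<lambda>p. indicator {t<..} (snd p) :: ennreal) \<in> borel_measurable (Q eps x)"
    unfolding measurable_cong_sets[OF sets_kernel[OF K] refl] by measurable
  have m2: "(\<lambda>p. indicator {0..} (t - snd p) :: ennreal) \<in> borel_measurable (Q eps x)"
    unfolding measurable_cong_sets[OF sets_kernel[OF K] refl] by measurable
  have "(\<Sum>n<Suc N. occ (Q eps) UNIV n x t) =
     occ (Q eps) UNIV 0 x t + (\<Sum>n<N. \<integral>\<^sup>+p. occ (Q eps) UNIV n (fst p) (t - snd p) \<partial>Q eps x)"
    unfolding sum.lessThan_Suc_shift by simp
  also have "\<dots> = occ (Q eps) UNIV 0 x t + (\<integral>\<^sup>+p. (\<Sum>n<N. occ (Q eps) UNIV n (fst p) (t - snd p)) \<partial>Q eps x)"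
    by (subst nn_integral_sum) (auto intro: measurable_occ_shift)
  also have "\<dots> \<le> occ (Q eps) UNIV 0 x t + (\<integral>\<^sup>+p. indicator {0..} (t - snd p) \<partial>Q eps x)"
    by (intro add_left_mono nn_integral_mono Suc)
  also have "\<dots> \<le> indicator {0..} t"
  proof (cases "0 \<le> t")
    case True
    have "occ (Q eps) UNIV 0 x t + (\<integral>\<^sup>+p. indicator {0..} (t - snd p) \<partial>Q eps x) =
      (\<integral>\<^sup>+p. indicator {t<..} (snd p) + indicator {0..} (t - snd p) \<partial>Q eps x)"
      using True by (simp add: nn_integral_add[OF m1 m2])
    also have "\<dots> = (\<integral>\<^sup>+p. 1 \<partial>Q eps x)"
      by (rule nn_integral_cong) (auto split: split_indicator)
    also have "\<dots> = 1" by (simp add: emeasure_space_1)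
    finally show ?thesis using True by simp
  next
    case False
    \<comment> \<open>For negative \<open>t\<close> the residual time is almost surely negative as
      well, because holding times are nonnegative.\<close>
    have "(\<integral>\<^sup>+p. indicator {0..} (t - snd p) \<partial>Q eps x) = (\<integral>\<^sup>+p. 0 \<partial>Q eps x)"
      by (rule nn_integral_cong_AE)
        (use AE_time_nonneg[of x] False in \<open>auto elim!: eventually_mono split: split_indicator\<close>)
    then show ?thesis using False by simp
  qed
  finally show ?case .
qed simp

lemma suminf_occ_UNIV_le: "(\<Sum>n. occ (Q eps) UNIV n x t) \<le> 1"
proof (rule suminf_le_const)
  show "(\<Sum>n<N. occ (Q eps) UNIV n x t) \<le> 1" for N
    using sum_occ_le[where N = N and x = x and t = t] by (rule order_trans) (auto split: split_indicator)
qed simp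

text \<open>The target set enters only through the indicator in the last sojourn, where disjointness
  bounds the sum of indicators by one; the integrals merely carry this bound along.\<close>

lemma sum_occ_disjoint_le:
  assumes J: "finite J" "disjoint_family_on S J" "\<And>j. j \<in> J \<Longrightarrow> S j \<in> sets borel"
  shows "(\<Sum>j\<in>J. occ (Q eps) (S j) n x t) \<le> occ (Q eps) UNIV n x t"
proof (induction n arbitrary: x t)
  case 0
  have "(\<Sum>j\<in>J. indicator (S j) x) = ennreal (\<Sum>j\<in>J. indicator (S j) x)"
    by (simp add: sum_ennreal[symmetric] ennreal_indicator)
  also have "\<dots> = ennreal (indicator (\<Union>j\<in>J. S j) x)"
    by (simp add: indicator_UN_disjoint[OF J(1,2)])
  also have "\<dots> \<le> 1" by (auto split: split_indicator)
  finally have *: "(\<Sum>j\<in>J. indicator (S j) x) \<le> (1 :: ennreal)" .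
  show ?case
    using mult_right_mono[OF *, of "indicator {0..} t * (\<integral>\<^sup>+p. indicator {t<..} (snd p) \<partial>Q eps x)"]
    by (simp add: sum_distrib_right mult.assoc)
next
  case (Suc n)
  have "(\<Sum>j\<in>J. occ (Q eps) (S j) (Suc n) x t) =
    (\<integral>\<^sup>+p. (\<Sum>j\<in>J. occ (Q eps) (S j) n (fst p) (t - snd p)) \<partial>Q eps x)"
    by (subst nn_integral_sum) (auto intro: measurable_occ_shift J)
  also have "\<dots> \<le> occ (Q eps) UNIV (Suc n) x t"
    unfolding occ.simps by (intro nn_integral_mono Suc)
  finally show ?case .
qed

lemma sum_suminf_occ_le:
  assumes J: "finite J" "disjoint_family_on S J" "\<And>j. j \<in> J \<Longrightarrow> S j \<in> sets borel"
  shows "(\<Sum>j\<in>J. \<Sum>n. occ (Q eps) (S j) n x t) \<le> 1"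
proof -
  have "(\<Sum>j\<in>J. \<Sum>n. occ (Q eps) (S j) n x t) = (\<Sum>n. \<Sum>j\<in>J. occ (Q eps) (S j) n x t)"
    by (rule suminf_sum[symmetric]) simp
  also have "\<dots> \<le> (\<Sum>n. occ (Q eps) UNIV n x t)"
    by (intro suminf_le sum_occ_disjoint_le J) auto
  also have "\<dots> \<le> 1" by (rule suminf_occ_UNIV_le)
  finally show ?thesis .
qed

text \<open>Since \<open>enn2real\<close> sends infinity to 0, finiteness of the series must be
  known before the real-valued probability can be identified with it.\<close>

lemma ennreal_semiMarkovProb:
  assumes B: "B \<in> sets borel"
  shows "ennreal (semiMarkovProb Q eps x t B) = (\<Sum>n. occ (Q eps) B n x t)"
proof -
  have "(\<Sum>n. occ (Q eps) B n x t) \<le> 1"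
    \<comment> \<open>A one-element index type turns the bound for disjoint families into a bound
      for the single set \<open>B\<close>.\<close>
    using sum_suminf_occ_le[of "{()}" "\<lambda>_. B"] B by (simp add: disjoint_family_on_def)
  then have "(\<Sum>n. occ (Q eps) B n x t) < top"
    by (rule le_less_trans) simp
  then show ?thesis unfolding semiMarkovProb_eq[OF B] by (rule ennreal_enn2real)
qed

lemma semiMarkovProb_nonneg: "0 \<le> semiMarkovProb Q eps x t B"
  by (simp add: semiMarkovProb_def)

lemma sum_semiMarkovProb_le_1:
  assumes J: "finite J" "disjoint_family_on S J" "\<And>j. j \<in> J \<Longrightarrow> S j \<in> sets borel"
  shows "(\<Sum>j\<in>J. semiMarkovProb Q eps x t (S j)) \<le> 1"
proof -
  have "ennreal (\<Sum>j\<in>J. semiMarkovProb Q eps x t (S j)) = (\<Sum>j\<in>J. \<Sum>n. occ (Q eps) (S j) n x t)"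
    using J by (simp add: sum_ennreal[symmetric] semiMarkovProb_nonneg ennreal_semiMarkovProb)
  also have "\<dots> \<le> 1" by (rule sum_suminf_occ_le[OF J])
  finally show ?thesis by simp
qed

text \<open>The term \<open>n = 0\<close> accounts for the first sojourn; in the others, monotone
  convergence moves the series under the integral over the first jump.\<close>

lemma semiMarkovProb_renewal:
  assumes B: "B \<in> sets borel"
  shows "ennreal (semiMarkovProb Q eps x t B) = occ (Q eps) B 0 x t +
    (\<integral>\<^sup>+p. ennreal (semiMarkovProb Q eps (fst p) (t - snd p) B) \<partial>Q eps x)"
proof -
  have "(\<Sum>n. occ (Q eps) B n x t) = (\<Sum>n. occ (Q eps) B (Suc n) x t) + occ (Q eps) B 0 x t"
    using suminf_offset[of "\<lambda>n. occ (Q eps) B n x t" 1] by (simp add: add.commute)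
  also have "(\<Sum>n. occ (Q eps) B (Suc n) x t) = (\<integral>\<^sup>+p. (\<Sum>n. occ (Q eps) B n (fst p) (t - snd p)) \<partial>Q eps x)"
    by (simp add: nn_integral_suminf[OF measurable_occ_shift[OF B]])
  finally show ?thesis by (simp add: ennreal_semiMarkovProb[OF B] add.commute)
qed

lemma semiMarkovProb_ge_stay:
  assumes B: "B \<in> sets borel" and x: "x \<in> B" and t: "0 \<le> t"
  shows "measure (Q eps x) (UNIV \<times> {t<..}) \<le> semiMarkovProb Q eps x t B"
proof -
  interpret prob_space "Q eps x" by (rule kernel_prob_space[OF K])
  have s: "UNIV \<times> {t<..} \<in> sets (Q eps x)" unfolding sets_kernel[OF K]
    by (rule pair_measureI) auto
  have "occ (Q eps) B 0 x t = (\<integral>\<^sup>+p. indicator (UNIV \<times> {t<..}) p \<partial>Q eps x)"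
    using x t by (auto intro!: nn_integral_cong split: split_indicator)
  also have "\<dots> = ennreal (measure (Q eps x) (UNIV \<times> {t<..}))"
    using s by (simp add: emeasure_eq_measure)
  finally have "ennreal (measure (Q eps x) (UNIV \<times> {t<..})) \<le> ennreal (semiMarkovProb Q eps x t B)"
    by (subst semiMarkovProb_renewal[OF B]) simp
  then show ?thesis by (simp add: semiMarkovProb_nonneg)
qed

text \<open>Only paths whose first jump occurs by time \<open>s\<close> and lands in some
  \<open>S k\<close> are kept. The residual time then lies between \<open>t - s\<close> and
  \<open>t\<close>, where the bound \<open>b k\<close> applies. Subtracting the tail of the holding
  time from \<open>Pk\<close> makes independence of target and time irrelevant.\<close>

lemma semiMarkovProb_ge_step:
  assumes B: "B \<in> sets borel"
    and J: "finite J" "disjoint_family_on S J" "\<And>j. j \<in> J \<Longrightarrow> S j \<in> sets borel"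
    and b: "\<And>k. k \<in> J \<Longrightarrow> 0 \<le> b k"
    and lower: "\<And>k z v. k \<in> J \<Longrightarrow> z \<in> S k \<Longrightarrow> t - s \<le> v \<Longrightarrow> v \<le> t \<Longrightarrow> b k \<le> semiMarkovProb Q eps z v B"
  shows "(\<Sum>k\<in>J. b k * (Pk Q eps x (S k) - measure (Q eps x) (UNIV \<times> {s<..})))
    \<le> semiMarkovProb Q eps x t B"
proof -
  interpret prob_space "Q eps x" by (rule kernel_prob_space[OF K])
  have rect: "A \<times> I \<in> sets (Q eps x)" if "A \<in> sets borel" "I \<in> sets borel" for A I
    unfolding sets_kernel[OF K] using that by (rule pair_measureI)
  have "(\<Sum>k\<in>J. b k * (Pk Q eps x (S k) - measure (Q eps x) (UNIV \<times> {s<..}))) \<le>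
    (\<Sum>k\<in>J. b k * measure (Q eps x) (S k \<times> {0..s}))"
  proof (intro sum_mono mult_left_mono b)
    fix k assume k: "k \<in> J"
    \<comment> \<open>The jump into \<open>S k\<close> is early, late, or has negative holding time;
      the last event is null.\<close>
    have "measure (Q eps x) (S k \<times> UNIV) \<le>
      measure (Q eps x) ((S k \<times> {0..s} \<union> UNIV \<times> {s<..}) \<union> UNIV \<times> {..<0})"
      using J(3)[OF k] by (intro finite_measure_mono sets.Un rect) auto
    also have "\<dots> \<le> measure (Q eps x) (S k \<times> {0..s}) + measure (Q eps x) (UNIV \<times> {s<..})
        + measure (Q eps x) (UNIV \<times> {..<0})"
      using J(3)[OF k]
      by (intro order_trans[OF measure_Un_le] add_right_mono measure_Un_le sets.Un rect) auto
    also have "measure (Q eps x) (UNIV \<times> {..<0}) = 0"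
      using nonneg[of x] by (simp add: measure_def)
    finally show "Pk Q eps x (S k) - measure (Q eps x) (UNIV \<times> {s<..}) \<le> measure (Q eps x) (S k \<times> {0..s})"
      by (simp add: Pk_def)
  qed auto
  also have "\<dots> \<le> semiMarkovProb Q eps x t B"
  proof -
    have "ennreal (\<Sum>k\<in>J. b k * measure (Q eps x) (S k \<times> {0..s})) =
      (\<Sum>k\<in>J. ennreal (b k) * emeasure (Q eps x) (S k \<times> {0..s}))"
      using b by (simp add: sum_ennreal[symmetric] ennreal_mult emeasure_eq_measure)
    also have "\<dots> = (\<Sum>k\<in>J. \<integral>\<^sup>+p. ennreal (b k) * indicator (S k \<times> {0..s}) p \<partial>Q eps x)"
      using J(3) by (intro sum.cong refl nn_integral_cmult_indicator[symmetric] rect) auto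
    also have "\<dots> = (\<integral>\<^sup>+p. (\<Sum>k\<in>J. ennreal (b k) * indicator (S k \<times> {0..s}) p) \<partial>Q eps x)"
    proof (rule nn_integral_sum[symmetric])
      fix k assume "k \<in> J"
      then have [measurable]: "S k \<times> {0..s} \<in> sets (Q eps x)" using J(3) by (intro rect) auto
      show "(\<lambda>p. ennreal (b k) * indicator (S k \<times> {0..s}) p) \<in> borel_measurable (Q eps x)" by measurable
    qed
    also have "\<dots> \<le> (\<integral>\<^sup>+p. ennreal (semiMarkovProb Q eps (fst p) (t - snd p) B) \<partial>Q eps x)"
    proof (rule nn_integral_mono)
      fix p :: "'a \<times> real"
      show "(\<Sum>k\<in>J. ennreal (b k) * indicator (S k \<times> {0..s}) p) \<le> ennreal (semiMarkovProb Q eps (fst p) (t - snd p) B)"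
      proof (cases "\<exists>k\<in>J. p \<in> S k \<times> {0..s}")
        case True
        then obtain k where k: "k \<in> J" "p \<in> S k \<times> {0..s}" by blast
        \<comment> \<open>By disjointness only one rectangle contains \<open>p\<close>, so the sum
          collapses to a single \<open>b k\<close>.\<close>
        have "p \<notin> S l \<times> {0..s}" if "l \<in> J" "l \<noteq> k" for l
          using disjoint_family_onD[OF J(2) that(1) k(1) that(2)] k(2) by auto
        then have "(\<Sum>l\<in>J. ennreal (b l) * indicator (S l \<times> {0..s}) p) =
          (\<Sum>l\<in>J. if l = k then ennreal (b k) else 0)"
          using k(2) by (intro sum.cong) auto
        also have "\<dots> = ennreal (b k)" using J(1) k(1) by simp
        also have "\<dots> \<le> ennreal (semiMarkovProb Q eps (fst p) (t - snd p) B)"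
          using k lower[of k "fst p" "t - snd p"] by (intro ennreal_leI) auto
        finally show ?thesis .
      next
        case False
        then have "(\<Sum>k\<in>J. ennreal (b k) * indicator (S k \<times> {0..s}) p) = 0"
          by (intro sum.neutral) auto
        then show ?thesis by simp
      qed
    qed
    also have "\<dots> \<le> ennreal (semiMarkovProb Q eps x t B)"
      by (subst (2) semiMarkovProb_renewal[OF B]) simp
    finally show ?thesis by (simp add: semiMarkovProb_nonneg)
  qed
  finally show ?thesis .
qed

end

section \<open>Holding-time laws conditioned on the target of the jump\<close>

text \<open>The law of total probability over the target, with the weights \<open>Pk\<close> bounded
  by one: it serves to pass smallness from the conditional laws to the unconditional one. Targets of
  probability zero are left out, since conditioning on them yields no probability measure.\<close>

lemma measure_le_sum_condT:
  assumes J: "finite J" "disjoint_family_on S J" "\<And>j. j \<in> J \<Longrightarrow> S j \<in> sets borel"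
    and cover: "(\<Union>j\<in>J. S j) = UNIV" and I: "I \<in> sets borel"
  shows "measure (Q eps x) (UNIV \<times> I) \<le>
    (\<Sum>j | j \<in> J \<and> 0 < Pk Q eps x (S j). measure (condT Q eps x (S j)) I)"
proof -
  interpret prob_space "Q eps x" by (rule kernel_prob_space[OF K])
  have rect: "A \<times> I \<in> sets (Q eps x)" if "A \<in> sets borel" "I \<in> sets borel" for A I
    unfolding sets_kernel[OF K] using that by (rule pair_measureI)
  have "measure (Q eps x) (UNIV \<times> I) = measure (Q eps x) (\<Union>j\<in>J. S j \<times> I)"
    using cover by (intro arg_cong[where f = "measure _"]) auto
  also have "\<dots> \<le> (\<Sum>j\<in>J. measure (Q eps x) (S j \<times> I))"
    using J I by (intro finite_measure_subadditive_finite) (auto intro: rect)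
  also have "\<dots> = (\<Sum>j | j \<in> J \<and> 0 < Pk Q eps x (S j). measure (Q eps x) (S j \<times> I))"
  proof (rule sum.mono_neutral_right)
    show "\<forall>j\<in>J - {j \<in> J. 0 < Pk Q eps x (S j)}. measure (Q eps x) (S j \<times> I) = 0"
    proof
      fix j assume j: "j \<in> J - {j \<in> J. 0 < Pk Q eps x (S j)}"
      have "measure (Q eps x) (S j \<times> I) \<le> measure (Q eps x) (S j \<times> UNIV)"
        using J(3) j by (intro finite_measure_mono rect) auto
      also have "\<dots> \<le> 0" using j by (auto simp: Pk_def)
      finally show "measure (Q eps x) (S j \<times> I) = 0" by (simp add: measure_le_0_iff)
    qed
  qed (use J in auto)
  also have "\<dots> \<le> (\<Sum>j | j \<in> J \<and> 0 < Pk Q eps x (S j). measure (condT Q eps x (S j)) I)"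
  proof (rule sum_mono)
    fix j assume j: "j \<in> {j \<in> J. 0 < Pk Q eps x (S j)}"
    have m: "snd \<in> uniform_measure (Q eps x) (S j \<times> UNIV) \<rightarrow>\<^sub>M borel"
      using measurable_snd by (simp add: measurable_cong_sets[OF sets_kernel[OF K] refl] cong: measurable_cong_sets)
    have "measure (condT Q eps x (S j)) I = measure (uniform_measure (Q eps x) (S j \<times> UNIV)) (UNIV \<times> I)"
      unfolding condT_def
      by (subst measure_distr[OF m I]) (auto intro!: arg_cong[where f = "measure _"] simp: space_kernel[OF K])
    also have "\<dots> = measure (Q eps x) (S j \<times> I) / measure (Q eps x) (S j \<times> UNIV)"
      using j J(3) I by (subst measure_uniform_measure)
        (auto intro!: rect arg_cong2[where f = "(/)"] arg_cong[where f = "measure _"] simp: Pk_def emeasure_eq_measure)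
    also have "\<dots> \<ge> measure (Q eps x) (S j \<times> I)"
    proof -
      have "measure (Q eps x) (S j \<times> I) * measure (Q eps x) (S j \<times> UNIV) \<le> measure (Q eps x) (S j \<times> I)"
        by (rule mult_left_le) auto
      then show ?thesis using j by (auto simp: Pk_def pos_le_divide_eq)
    qed
    finally show "measure (Q eps x) (S j \<times> I) \<le> measure (condT Q eps x (S j)) I" .
  qed
  finally show ?thesis .
qed

lemma prob_space_condT:
  assumes "B \<in> sets borel" "0 < Pk Q eps x B"
  shows "prob_space (condT Q eps x B)"
proof -
  interpret prob_space "Q eps x" by (rule kernel_prob_space[OF K])
  have m: "snd \<in> uniform_measure (Q eps x) (B \<times> UNIV) \<rightarrow>\<^sub>M borel"
    using measurable_snd by (simp add: measurable_cong_sets[OF sets_kernel[OF K] refl] cong: measurable_cong_sets)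
  have "prob_space (uniform_measure (Q eps x) (B \<times> UNIV))"
    using assms by (intro prob_space_uniform_measure) (auto simp: Pk_def emeasure_eq_measure)
  then show ?thesis unfolding condT_def by (rule prob_space.prob_space_distr[OF _ m])
qed

lemma AE_condT_nonneg:
  assumes B: "B \<in> sets borel" "0 < Pk Q eps x B"
    and nonneg: "\<And>x. emeasure (Q eps x) (UNIV \<times> {..<0}) = 0"
  shows "AE s in condT Q eps x B. 0 \<le> s"
proof -
  interpret prob_space "Q eps x" by (rule kernel_prob_space[OF K])
  have m: "snd \<in> uniform_measure (Q eps x) (B \<times> UNIV) \<rightarrow>\<^sub>M borel"
    using measurable_snd by (simp add: measurable_cong_sets[OF sets_kernel[OF K] refl] cong: measurable_cong_sets)
  have BU: "B \<times> UNIV \<in> sets (Q eps x)" unfolding sets_kernel[OF K] using B(1) by (rule pair_measureI) auto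
  have "AE p in uniform_measure (Q eps x) (B \<times> UNIV). 0 \<le> snd p"
    using AE_time_nonneg[OF nonneg, of x] B(2) BU
    by (subst AE_uniform_measure) (auto simp: Pk_def emeasure_eq_measure elim!: eventually_mono)
  then show ?thesis unfolding condT_def by (subst AE_distr_iff[OF m]) auto
qed

end

lemma sets_condT [simp]: "sets (condT Q eps x B) = sets borel"
  and space_condT [simp]: "space (condT Q eps x B) = UNIV"
  by (simp_all add: condT_def)

section \<open>Distributions without mass near zero, and hitting probabilities\<close>

text \<open>Bounded means give tightness. If the mass of \<open>{..a n}\<close> stayed above some
  \<open>e\<close> along a subsequence, a further subsequence would converge weakly to a law without
  atoms. Its distribution function is continuous, yet vanishes to the left of 0 and is at least
  \<open>e\<close> to the right, which is impossible.\<close>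

lemma measure_atMost_tendsto_0:
  fixes \<mu> :: "nat \<Rightarrow> real measure"
  assumes rd: "\<And>n. real_distribution (\<mu> n)"
    and nonneg: "\<And>n. AE x in \<mu> n. 0 \<le> x"
    and int: "\<And>n. integrable (\<mu> n) (\<lambda>x. x)"
    and mean: "\<And>n. (\<integral>x. x \<partial>\<mu> n) \<le> m"
    and noatoms: "\<And>r \<xi> y. strict_mono (r :: nat \<Rightarrow> nat) \<Longrightarrow> real_distribution \<xi> \<Longrightarrow>
      weak_conv_m (\<lambda>n. \<mu> (r n)) \<xi> \<Longrightarrow> measure \<xi> {y} = 0"
    and a: "a \<longlonglongrightarrow> 0"
  shows "(\<lambda>n. measure (\<mu> n) {..a n}) \<longlonglongrightarrow> 0"
proof (rule ccontr)
  interpret \<mu>: real_distribution "\<mu> n" for n by (rule rd)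
  have m0: "0 \<le> m"
    using integral_nonneg_AE[OF nonneg[of 0]] mean[of 0] by linarith
  have tight: "tight \<mu>"
    unfolding tight_def
  proof (intro conjI allI impI rd)
    fix \<epsilon> :: real assume \<epsilon>: "0 < \<epsilon>"
    \<comment> \<open>Markov's inequality bounds the mass beyond \<open>b\<close> by
      \<open>m / b\<close>; the summand 1 keeps \<open>b\<close> positive and the inequality strict
      even if \<open>m\<close> is 0.\<close>
    define b where "b = (m + 1) / \<epsilon>"
    have b: "0 < b" using m0 \<epsilon> by (simp add: b_def)
    have "1 - \<epsilon> < measure (\<mu> n) {-1<..b}" for n
    proof -
      have "measure (\<mu> n) {x \<in> space (\<mu> n). b \<le> x} \<le> (\<integral>x. x \<partial>\<mu> n) / b"
        by (rule integral_Markov_inequality_measure[OF int _ nonneg b, of "{}"]) simp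
      also have "\<dots> \<le> m / b" using mean b by (intro divide_right_mono) auto
      also have "\<dots> < \<epsilon>" using m0 \<epsilon> by (simp add: b_def field_simps)
      finally have tail: "measure (\<mu> n) {b..} < \<epsilon>" by (simp add: atLeast_def)
      \<comment> \<open>The definition of \<open>tight\<close> uses intervals open on the left, so
        the left end is put at -1: with 0 an atom at 0 would be lost.\<close>
      have neg: "measure (\<mu> n) {..-1} = 0"
        using nonneg[of n] by (subst \<mu>.prob_eq_0) (auto elim!: eventually_mono)
      have "({..-1} \<union> {b..}) \<union> {-1<..b} = UNIV" by auto
      then have "1 = measure (\<mu> n) (({..-1} \<union> {b..}) \<union> {-1<..b})"
        using \<mu>.prob_space[of n] by simp
      also have "\<dots> \<le> measure (\<mu> n) {..-1} + measure (\<mu> n) {b..} + measure (\<mu> n) {-1<..b}"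
        by (intro order_trans[OF measure_Un_le] add_right_mono measure_Un_le) auto
      finally show ?thesis using tail neg by simp
    qed
    then show "\<exists>a b. a < b \<and> (\<forall>n. 1 - \<epsilon> < measure (\<mu> n) {a<..b})"
      using b by (intro exI[of _ "-1"] exI[of _ b]) auto
  qed
  assume "\<not> ?thesis"
  then obtain e where e: "0 < e" "\<not> (\<forall>\<^sub>F n in sequentially. measure (\<mu> n) {..a n} < e)"
    by (auto simp: tendsto_iff)
  then have "infinite {n. e \<le> measure (\<mu> n) {..a n}}"
    by (auto simp: not_eventually frequently_sequentially not_less infinite_nat_iff_unbounded_le)
  then obtain s :: "nat \<Rightarrow> nat" where s: "strict_mono s" "\<And>n. e \<le> measure (\<mu> (s n)) {..a (s n)}"
    using infinite_enumerate[of "{n. e \<le> measure (\<mu> n) {..a n}}"] by auto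
  obtain r \<xi> where r: "strict_mono (r :: nat \<Rightarrow> nat)" and \<xi>: "real_distribution \<xi>"
    and wc: "weak_conv_m (\<mu> \<circ> s \<circ> r) \<xi>"
    using tight_imp_convergent_subsubsequence[OF tight s(1)] by blast
  interpret \<xi>: real_distribution \<xi> by (rule \<xi>)
  have sr: "strict_mono (\<lambda>n. s (r n))" using s(1) r by (simp add: strict_mono_def)
  have wc': "weak_conv_m (\<lambda>n. \<mu> (s (r n))) \<xi>" using wc by (simp add: comp_def)
  have cont: "isCont (cdf \<xi>) y" for y
    using noatoms[OF sr \<xi> wc'] by (simp add: \<xi>.isCont_cdf)
  have lim: "(\<lambda>n. cdf (\<mu> (s (r n))) y) \<longlonglongrightarrow> cdf \<xi> y" for y
    using wc' cont by (simp add: weak_conv_m_def weak_conv_def)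
  have pos: "e \<le> cdf \<xi> y" if y: "0 < y" for y
  proof -
    \<comment> \<open>The thresholds eventually fall below the fixed \<open>y\<close>, so the lower
      bound \<open>e\<close> passes to the distribution function at \<open>y\<close> and then to the
      weak limit.\<close>
    have "(\<lambda>n. a (s (r n))) \<longlonglongrightarrow> 0"
      using LIMSEQ_subseq_LIMSEQ[OF a sr] by (simp add: comp_def)
    then have "\<forall>\<^sub>F n in sequentially. a (s (r n)) < y"
      using y by (rule order_tendstoD)
    then have "\<forall>\<^sub>F n in sequentially. e \<le> cdf (\<mu> (s (r n))) y"
    proof eventually_elim
      case (elim n)
      have "e \<le> cdf (\<mu> (s (r n))) (a (s (r n)))"
        using s(2)[of "r n"] by (simp add: cdf_def2)
      also have "\<dots> \<le> cdf (\<mu> (s (r n))) y"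
        using elim by (intro \<mu>.cdf_nondecreasing) simp
      finally show ?case .
    qed
    then show ?thesis by (rule tendsto_lowerbound[OF lim]) simp
  qed
  have neg: "cdf \<xi> y = 0" if "y < 0" for y
  proof -
    have "cdf (\<mu> n) y = 0" for n
      unfolding cdf_def2 using nonneg[of n] that by (subst \<mu>.prob_eq_0) (auto elim!: eventually_mono)
    then show ?thesis using lim[of y] by (simp add: LIMSEQ_const_iff)
  qed
  have right: "(cdf \<xi> \<longlongrightarrow> cdf \<xi> 0) (at_right 0)" and left: "(cdf \<xi> \<longlongrightarrow> cdf \<xi> 0) (at_left 0)"
    using cont[of 0] by (auto simp: isCont_def intro: tendsto_within_subset)
  have "e \<le> cdf \<xi> 0"
    by (rule tendsto_lowerbound[OF right]) (auto intro!: pos eventually_at_rightI[of 0 1])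
  moreover have "cdf \<xi> 0 \<le> 0"
    by (rule tendsto_upperbound[OF left]) (auto simp: neg intro!: eventually_at_leftI[of "-1"])
  ultimately show False using e(1) by simp
qed

text \<open>The diagonal of \<open>p\<close> is ignored: a transition matrix of jump probabilities carries no
  meaningful diagonal entries.\<close>

primrec hit_within :: "('b \<Rightarrow> 'b \<Rightarrow> real) \<Rightarrow> 'b set \<Rightarrow> 'b set \<Rightarrow> nat \<Rightarrow> 'b \<Rightarrow> 'b \<Rightarrow> real" where
  "hit_within p C D 0 i j = (if i \<in> D \<and> i = j then 1 else 0)"
| "hit_within p C D (Suc n) i j =
    (if i \<in> D then if i = j then 1 else 0 else \<Sum>k\<in>C - {i}. p i k * hit_within p C D n k j)"

context
  fixes p :: "'b \<Rightarrow> 'b \<Rightarrow> real" and C D :: "'b set"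
  assumes finC: "finite C" and DC: "D \<subseteq> C"
    and p_nonneg: "\<And>i k. i \<in> C \<Longrightarrow> k \<in> C \<Longrightarrow> i \<noteq> k \<Longrightarrow> 0 \<le> p i k"
    and p_sum: "\<And>i. i \<in> C \<Longrightarrow> (\<Sum>k\<in>C - {i}. p i k) = 1"
begin

lemma hit_within_nonneg: "i \<in> C \<Longrightarrow> 0 \<le> hit_within p C D n i j"
  by (induction n arbitrary: i) (auto intro!: sum_nonneg mult_nonneg_nonneg p_nonneg)

lemma hit_within_sum_le_1: "i \<in> C \<Longrightarrow> (\<Sum>j\<in>D. hit_within p C D n i j) \<le> 1"
proof (induction n arbitrary: i)
  case 0
  have "finite D" using finC DC by (rule finite_subset[rotated])
  then show ?case by (cases "i \<in> D") auto
next
  case (Suc n)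
  have fin: "finite D" using finC DC by (rule finite_subset[rotated])
  show ?case
  proof (cases "i \<in> D")
    case True
    then show ?thesis using fin by simp
  next
    case False
    have "(\<Sum>j\<in>D. hit_within p C D (Suc n) i j) = (\<Sum>k\<in>C - {i}. p i k * (\<Sum>j\<in>D. hit_within p C D n k j))"
      using False by (simp add: sum_distrib_left sum.swap[of _ D])
    also have "\<dots> \<le> (\<Sum>k\<in>C - {i}. p i k * 1)"
      using Suc by (intro sum_mono mult_left_mono p_nonneg) auto
    finally show ?thesis using p_sum[OF Suc.prems] by simp
  qed
qed

lemma hit_within_le_1: "i \<in> C \<Longrightarrow> hit_within p C D n i j \<le> 1"
proof (induction n arbitrary: i)
  case (Suc n)
  have "(\<Sum>k\<in>C - {i}. p i k * hit_within p C D n k j) \<le> (\<Sum>k\<in>C - {i}. p i k * 1)"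
    using Suc by (intro sum_mono mult_left_mono p_nonneg) auto
  then show ?case using p_sum[OF Suc.prems] by simp
qed simp

lemma hit_within_mono: "i \<in> C \<Longrightarrow> hit_within p C D n i j \<le> hit_within p C D (Suc n) i j"
proof (induction n arbitrary: i)
  case 0
  then show ?case by (auto intro!: sum_nonneg mult_nonneg_nonneg p_nonneg)
next
  case (Suc n)
  \<comment> \<open>The recursion is unfolded exactly once on each side, so that the remaining terms
    at levels \<open>n\<close> and \<open>Suc n\<close> match the induction hypothesis.\<close>
  then show ?case
    by (simp del: hit_within.simps(2) add: hit_within.simps(2)[of _ _ _ "Suc n"] hit_within.simps(2)[of _ _ _ n] )
      (auto intro!: sum_mono mult_left_mono p_nonneg)
qed

lemma hit_within_outside: "j \<notin> D \<Longrightarrow> hit_within p C D n i j = 0"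
  by (induction n arbitrary: i) auto

text \<open>Monotone bounded sequences converge, so the point is that no mass is lost. The total
  mass \<open>m\<close> equals 1 on \<open>D\<close> and is harmonic off \<open>D\<close>; its
  minimum spreads along a path into \<open>D\<close>, where the value is 1.\<close>

lemma hitting_distribution:
  assumes reach: "\<And>i. i \<in> C \<Longrightarrow> \<exists>d\<in>D. (i, d) \<in> {(a, b). a \<in> C \<and> b \<in> C \<and> 0 < p a b}\<^sup>*"
  obtains \<mu> where "\<And>i j. i \<in> C \<Longrightarrow> (\<lambda>n. hit_within p C D n i j) \<longlonglongrightarrow> \<mu> i j"
    and "\<And>i j. i \<in> C \<Longrightarrow> 0 \<le> \<mu> i j" and "\<And>i j. i \<in> C \<Longrightarrow> j \<notin> D \<Longrightarrow> \<mu> i j = 0"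
    and "\<And>i. i \<in> C \<Longrightarrow> (\<Sum>j\<in>D. \<mu> i j) = 1"
proof -
  have fin: "finite D" using finC DC by (rule finite_subset[rotated])
  define \<mu> where "\<mu> i j = lim (\<lambda>n. hit_within p C D n i j)" for i j
  have lim: "(\<lambda>n. hit_within p C D n i j) \<longlonglongrightarrow> \<mu> i j" if "i \<in> C" for i j
  proof -
    have "incseq (\<lambda>n. hit_within p C D n i j)"
      using hit_within_mono[OF that] by (rule incseq_SucI)
    moreover have "\<forall>n. hit_within p C D n i j \<le> 1"
      using hit_within_le_1[OF that] by blast
    ultimately have "convergent (\<lambda>n. hit_within p C D n i j)"
      by (meson incseq_convergent convergentI)
    then show ?thesis unfolding \<mu>_def by (rule convergent_LIMSEQ_iff[THEN iffD1])
  qed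
  define m where "m i = (\<Sum>j\<in>D. \<mu> i j)" for i
  have limm: "(\<lambda>n. \<Sum>j\<in>D. hit_within p C D n i j) \<longlonglongrightarrow> m i" if "i \<in> C" for i
    unfolding m_def by (intro tendsto_sum lim that)
  have m_le: "m i \<le> 1" if "i \<in> C" for i
    by (rule LIMSEQ_le_const2[OF limm[OF that]]) (use hit_within_sum_le_1[OF that] in blast)
  have m_D: "m i = 1" if "i \<in> D" for i
  proof -
    have "hit_within p C D n i j = (if i = j then 1 else 0)" for n j
      using that by (cases n) auto
    then have "(\<lambda>n. (\<Sum>j\<in>D. if i = j then 1 else 0 :: real)) \<longlonglongrightarrow> m i"
      using limm[of i] that DC by auto
    then show ?thesis using that fin by (simp add: LIMSEQ_const_iff)
  qed
  have m_harmonic: "m i = (\<Sum>k\<in>C - {i}. p i k * m k)" if "i \<in> C" "i \<notin> D" for i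
  proof -
    have "(\<lambda>n. \<Sum>k\<in>C - {i}. p i k * (\<Sum>j\<in>D. hit_within p C D n k j)) \<longlonglongrightarrow> (\<Sum>k\<in>C - {i}. p i k * m k)"
      by (intro tendsto_sum tendsto_mult tendsto_const limm) auto
    moreover have "(\<lambda>n. \<Sum>k\<in>C - {i}. p i k * (\<Sum>j\<in>D. hit_within p C D n k j)) =
        (\<lambda>n. \<Sum>j\<in>D. hit_within p C D (Suc n) i j)"
      using that by (simp add: sum_distrib_left sum.swap[of _ D])
    ultimately show ?thesis
      using LIMSEQ_Suc[OF limm[OF that(1)]] LIMSEQ_unique by metis
  qed
  have "m i = 1" if i: "i \<in> C" for i
  proof -
    define v where "v = Min (m ` C)"
    have v_le: "v \<le> m k" if "k \<in> C" for k using finC that by (simp add: v_def)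
    have "v \<in> m ` C" unfolding v_def using finC i by (intro Min_in) auto
    then obtain i0 where i0: "i0 \<in> C" "m i0 = v" by auto
    \<comment> \<open>A weighted average of the nonnegative differences \<open>m k - v\<close>
      vanishes at a minimum point, so each neighbour of positive weight also attains the minimum. A
      diagonal step changes nothing.\<close>
    have min_step: "m b = v" if "a \<in> C" "b \<in> C" "0 < p a b" "m a = v" "a \<notin> D" for a b
    proof (cases "a = b")
      case False
      have "(\<Sum>k\<in>C - {a}. p a k * (m k - v)) = m a - v"
        using p_sum[OF that(1)] m_harmonic[OF that(1,5)]
        by (simp add: right_diff_distrib sum_subtractf flip: sum_distrib_right)
      then have "(\<Sum>k\<in>C - {a}. p a k * (m k - v)) = 0" using that by simp
      moreover have "\<And>k. k \<in> C - {a} \<Longrightarrow> 0 \<le> p a k * (m k - v)"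
        using that v_le by (intro mult_nonneg_nonneg p_nonneg) auto
      ultimately have "\<forall>k\<in>C - {a}. p a k * (m k - v) = 0"
        using finC by (subst (asm) sum_nonneg_eq_0_iff) auto
      then have "p a b * (m b - v) = 0" using that(2) False by blast
      then show ?thesis using that(3) by simp
    qed (use that in simp)
    obtain d where d: "d \<in> D" "(i0, d) \<in> {(a, b). a \<in> C \<and> b \<in> C \<and> 0 < p a b}\<^sup>*"
      using reach[OF i0(1)] by blast
    \<comment> \<open>The path may enter \<open>D\<close> before reaching \<open>d\<close>, where
      harmonicity stops; the minimum is then already known to be 1, which is the second
      alternative.\<close>
    from d(2) have "m d = v \<or> v = 1"
    proof (induction rule: rtrancl_induct)
      case base
      then show ?case using i0 by simp
    next
      case (step y z)
      then show ?case using min_step[of y z] m_D by (cases "y \<in> D") auto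
    qed
    then have "v = 1" using m_D[OF d(1)] by auto
    then show ?thesis using v_le[OF i] m_le[OF i] by simp
  qed
  moreover have "0 \<le> \<mu> i j" if "i \<in> C" for i j
    by (rule LIMSEQ_le_const[OF lim[OF that]]) (use hit_within_nonneg[OF that] in blast)
  moreover have "\<mu> i j = 0" if "i \<in> C" "j \<notin> D" for i j
    using lim[OF that(1), of j] hit_within_outside[OF that(2)] by (simp add: LIMSEQ_const_iff)
  ultimately show ?thesis using that lim unfolding m_def by blast
qed

end

section \<open>Asymptotics of the semi-Markov process\<close>

text \<open>The setting with assumptions (a), (b) and (e), the integrability supplied by (c), and
  the instance of (f) with one ratio and one state in both time factors. The quotient
  \<open>tau i eps / tau i eps\<close> stays because positivity of \<open>tau\<close> is only
  derived below.\<close>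

locale semi_markov_family =
  fixes Q :: "real \<Rightarrow> 'a::metric_space \<Rightarrow> ('a \<times> real) measure"
    and S :: "nat \<Rightarrow> 'a set" and M :: nat
    and Pij :: "nat \<Rightarrow> nat \<Rightarrow> real \<Rightarrow> real" and tau :: "nat \<Rightarrow> real \<Rightarrow> real"
  assumes kernel: "\<And>eps. 0 < eps \<Longrightarrow> Q eps \<in> borel \<rightarrow>\<^sub>M prob_algebra SP"
    and times_nonneg: "\<And>eps x. 0 < eps \<Longrightarrow> emeasure (Q eps x) (UNIV \<times> {..<0}) = 0"
    and S_meas: "\<And>i. i \<in> {1..M} \<Longrightarrow> S i \<in> sets borel"
    and S_disj: "disjoint_family_on S {1..M}"
    and S_cover: "(\<Union>i\<in>{1..M}. S i) = UNIV"
    and noself: "\<And>i eps x. i \<in> {1..M} \<Longrightarrow> 0 < eps \<Longrightarrow> x \<in> S i \<Longrightarrow> Pk Q eps x (S i) = 0"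
    and dichotomy: "\<And>i j. i \<in> {1..M} \<Longrightarrow> j \<in> {1..M} \<Longrightarrow> i \<noteq> j \<Longrightarrow>
      (\<forall>eps>0. \<forall>x\<in>S i. Pk Q eps x (S j) = 0) \<or> posTrans Q S i j"
    and Pij_asym: "\<And>i j. i \<in> {1..M} \<Longrightarrow> j \<in> {1..M} \<Longrightarrow> i \<noteq> j \<Longrightarrow> posTrans Q S i j \<Longrightarrow>
      uniform_limit (S i) (\<lambda>eps x. Pk Q eps x (S j) / Pij i j eps) (\<lambda>_. 1) (at_right 0)"
    and Pij_zero: "\<And>i j eps. i \<in> {1..M} \<Longrightarrow> j \<in> {1..M} \<Longrightarrow> i \<noteq> j \<Longrightarrow> \<not> posTrans Q S i j \<Longrightarrow>
      0 < eps \<Longrightarrow> Pij i j eps = 0"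
    and Pij_sum: "\<And>i eps. i \<in> {1..M} \<Longrightarrow> 0 < eps \<Longrightarrow> (\<Sum>j\<in>{1..M} - {i}. Pij i j eps) = 1"
    and connected: "\<And>i j. i \<in> {1..M} \<Longrightarrow> j \<in> {1..M} \<Longrightarrow> i \<noteq> j \<Longrightarrow>
      \<exists>(k::nat) (p::nat \<Rightarrow> nat). p 0 = i \<and> p k = j \<and>
        (\<forall>r<k. p r \<in> {1..M} \<and> (\<forall>eps>0. Pij (p r) (p (Suc r)) eps > 0))"
    and mean: "\<And>i j. i \<in> {1..M} \<Longrightarrow> j \<in> {1..M} \<Longrightarrow> posTrans Q S i j \<Longrightarrow>
      uniform_limit (S i) (\<lambda>eps x. (\<integral>s. s \<partial>condT Q eps x (S j)) / tau i eps) (\<lambda>_. 1) (at_right 0)"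
    and integrable: "\<And>i j. i \<in> {1..M} \<Longrightarrow> j \<in> {1..M} \<Longrightarrow> posTrans Q S i j \<Longrightarrow>
      \<forall>\<^sub>F eps in at_right 0. \<forall>x\<in>S i. integrable (condT Q eps x (S j)) (\<lambda>s. s)"
    and noatoms: "\<And>i j xs es \<xi> a. i \<in> {1..M} \<Longrightarrow> j \<in> {1..M} \<Longrightarrow> posTrans Q S i j \<Longrightarrow>
      (\<And>n. xs n \<in> S i) \<Longrightarrow> (\<And>n. 0 < es n) \<Longrightarrow> decseq es \<Longrightarrow> es \<longlonglongrightarrow> 0 \<Longrightarrow> real_distribution \<xi> \<Longrightarrow>
      weak_conv_m (\<lambda>n. distr (condT Q (es n) (xs n) (S j)) borel (\<lambda>s. s / tau i (es n))) \<xi> \<Longrightarrow>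
      measure \<xi> {a} = 0"
    and ratio_limit: "\<And>i j d. i \<in> {1..M} \<Longrightarrow> j \<in> {1..M} \<Longrightarrow> d \<in> {1..M} \<Longrightarrow> i \<noteq> j \<Longrightarrow> i \<noteq> d \<Longrightarrow>
      posTrans Q S i d \<Longrightarrow>
      \<exists>L\<ge>0. ((\<lambda>eps. ereal (Pij i j eps / Pij i d eps * (tau i eps / tau i eps))) \<longlongrightarrow> L) (at_right 0)"
begin

section \<open>Positivity and existence of the limiting transition probabilities\<close>

text \<open>Uniform limits over an empty \<open>S i\<close> would say nothing, so later arguments
  need a point. The cover gives one nonempty set, and a positive probability of moving to the next
  set of a connecting path makes that set nonempty too.\<close>

lemma S_nonempty:
  assumes j: "j \<in> {1..M}"
  shows "S j \<noteq> {}"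
proof -
  obtain i where i: "i \<in> {1..M}" "S i \<noteq> {}" using S_cover by blast
  show ?thesis
  proof (cases "i = j")
    case False
    obtain k p where p: "p 0 = i" "p k = j"
      "\<And>r. r < k \<Longrightarrow> p r \<in> {1..M} \<and> (\<forall>eps>0. Pij (p r) (p (Suc r)) eps > 0)"
      using connected[OF i(1) j False] by blast
    have "p r \<in> {1..M} \<and> S (p r) \<noteq> {}" if "r \<le> k" for r
      using that
    proof (induction r)
      case 0
      then show ?case using i p by simp
    next
      case (Suc r)
      then have r: "p r \<in> {1..M}" "S (p r) \<noteq> {}" "Pij (p r) (p (Suc r)) 1 > 0"
        using p(3)[of r] by auto
      \<comment> \<open>The path condition places \<open>p r\<close> in the index range only for
        \<open>r < k\<close>; the endpoint is \<open>j\<close> itself.\<close>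
      have r': "p (Suc r) \<in> {1..M}"
        using p(2) p(3)[of "Suc r"] Suc.prems j by (cases "Suc r = k") auto
      show ?case
      \<comment> \<open>Diagonal values of \<open>Pij\<close> are unconstrained, so a path may
        contain idle steps.\<close>
      proof (cases "p r = p (Suc r)")
        case True
        then show ?thesis using r by simp
      next
        case False
        have "posTrans Q S (p r) (p (Suc r))"
          using Pij_zero[OF r(1) r' False, of 1] r(3) by auto
        moreover obtain x where "x \<in> S (p r)" using r(2) by blast
        ultimately have "0 < Pk Q 1 x (S (p (Suc r)))"
          unfolding posTrans_def using zero_less_one by blast
        then have "S (p (Suc r)) \<noteq> {}"
          by (auto simp: Pk_def)
        then show ?thesis using r' by simp
      qed
    qed
    from this[of k] p(2) show ?thesis by simp
  qed (use i in simp)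
qed

lemma posTrans_neq:
  assumes i: "i \<in> {1..M}" and pos: "posTrans Q S i j"
  shows "i \<noteq> j"
proof
  assume "i = j"
  obtain x where x: "x \<in> S i" using S_nonempty[OF i] by blast
  then have "0 < Pk Q 1 x (S j)" using pos unfolding posTrans_def using zero_less_one by blast
  then show False using noself[OF i _ x, of 1] \<open>i = j\<close> by simp
qed

lemma ex_posTrans:
  assumes i: "i \<in> {1..M}"
  shows "\<exists>j\<in>{1..M}. i \<noteq> j \<and> posTrans Q S i j"
proof (rule ccontr)
  assume "\<not> ?thesis"
  then have "(\<Sum>j\<in>{1..M} - {i}. Pij i j 1) = 0"
    using i by (intro sum.neutral) (auto intro!: Pij_zero)
  then show False using Pij_sum[OF i, of 1] by simp
qed

lemma eventually_at_right_0_pos: "\<forall>\<^sub>F eps in at_right (0::real). 0 < eps"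
  by (rule eventually_at_right_less)

lemma posTransD: "posTrans Q S i j \<Longrightarrow> 0 < eps \<Longrightarrow> x \<in> S i \<Longrightarrow> 0 < Pk Q eps x (S j)"
  by (simp add: posTrans_def)

lemma condT_mean_nonneg:
  assumes "i \<in> {1..M}" "j \<in> {1..M}" "posTrans Q S i j" "0 < eps" "x \<in> S i"
  shows "0 \<le> (\<integral>s. s \<partial>condT Q eps x (S j))"
  using assms by (intro integral_nonneg_AE AE_condT_nonneg kernel S_meas posTransD times_nonneg)

text \<open>Positivity of \<open>tau\<close> is not postulated: means of nonnegative times are
  nonnegative, and their ratio to \<open>tau\<close> tends to 1. Division by zero yields 0, so a
  positive ratio also excludes \<open>tau i eps = 0\<close>.\<close>

lemma tau_pos:
  assumes i: "i \<in> {1..M}"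
  shows "\<forall>\<^sub>F eps in at_right 0. 0 < tau i eps"
proof -
  obtain j where j: "j \<in> {1..M}" "posTrans Q S i j" using ex_posTrans[OF i] by blast
  obtain x where x: "x \<in> S i" using S_nonempty[OF i] by blast
  have "((\<lambda>eps. (\<integral>s. s \<partial>condT Q eps x (S j)) / tau i eps) \<longlongrightarrow> 1) (at_right 0)"
    using tendsto_uniform_limitI[OF mean[OF i j] x] by simp
  then have "\<forall>\<^sub>F eps in at_right 0. 0 < (\<integral>s. s \<partial>condT Q eps x (S j)) / tau i eps"
    by (rule order_tendstoD) simp
  with eventually_at_right_0_pos show ?thesis
    by eventually_elim (use condT_mean_nonneg[OF i j _ x] in \<open>force simp: zero_less_divide_iff\<close>)
qed

text \<open>The same argument as for \<open>tau\<close>, with the positive numerator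
  \<open>Pk\<close>.\<close>

lemma Pij_pos:
  assumes i: "i \<in> {1..M}" "j \<in> {1..M}" "posTrans Q S i j"
  shows "\<forall>\<^sub>F eps in at_right 0. 0 < Pij i j eps"
proof -
  obtain x where x: "x \<in> S i" using S_nonempty[OF i(1)] by blast
  have "((\<lambda>eps. Pk Q eps x (S j) / Pij i j eps) \<longlongrightarrow> 1) (at_right 0)"
    using tendsto_uniform_limitI[OF Pij_asym[OF i(1,2) posTrans_neq[OF i(1,3)] i(3)] x] by simp
  then have "\<forall>\<^sub>F eps in at_right 0. 0 < Pk Q eps x (S j) / Pij i j eps"
    by (rule order_tendstoD) simp
  with eventually_at_right_0_pos show ?thesis
    by eventually_elim (use posTransD[OF i(3) _ x] in \<open>force simp: zero_less_divide_iff\<close>)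
qed

lemma Pij_nonneg:
  assumes i: "i \<in> {1..M}" "j \<in> {1..M}" "i \<noteq> j"
  shows "\<forall>\<^sub>F eps in at_right 0. 0 \<le> Pij i j eps"
proof (cases "posTrans Q S i j")
  case True
  then show ?thesis using Pij_pos[OF i(1,2)] by (auto elim: eventually_mono)
next
  case False
  show ?thesis using eventually_at_right_0_pos
    by eventually_elim (simp add: Pij_zero[OF i False])
qed

lemma Pij_le_1:
  assumes i: "i \<in> {1..M}" "j \<in> {1..M}" "i \<noteq> j"
  shows "\<forall>\<^sub>F eps in at_right 0. Pij i j eps \<le> 1"
proof -
  have "\<forall>\<^sub>F eps in at_right 0. \<forall>k\<in>{1..M} - {i}. 0 \<le> Pij i k eps"
    using i by (intro eventually_ball_finite ballI Pij_nonneg) auto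
  with eventually_at_right_0_pos show ?thesis
  proof eventually_elim
    case (elim eps)
    then have "Pij i j eps \<le> (\<Sum>k\<in>{1..M} - {i}. Pij i k eps)"
      using i by (intro member_le_sum) auto
    then show ?case using Pij_sum[OF i(1)] elim by simp
  qed
qed

text \<open>Regularity only controls ratios of transition probabilities; since each row sums to one,
  \<open>1 / P\<^sub>i\<^sub>d\<close> is the sum of the ratios \<open>P\<^sub>i\<^sub>j / P\<^sub>i\<^sub>d\<close>.\<close>

lemma Pij_tendsto:
  assumes i: "i \<in> {1..M}" "d \<in> {1..M}" "i \<noteq> d"
  shows "(Pij i d \<longlongrightarrow> P0 Pij i d) (at_right 0)"
proof -
  have "\<exists>l. (Pij i d \<longlongrightarrow> l) (at_right 0)"
  proof (cases "posTrans Q S i d")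
    case False
    have "((\<lambda>_. 0) \<longlongrightarrow> (0::real)) (at_right (0::real))" by simp
    then have "(Pij i d \<longlongrightarrow> 0) (at_right 0)"
      by (rule Lim_transform_eventually)
        (use eventually_at_right_0_pos in \<open>eventually_elim, simp add: Pij_zero[OF i False]\<close>)
    then show ?thesis by blast
  next
    case True
    have "\<exists>L\<ge>0. ((\<lambda>eps. ereal (Pij i j eps / Pij i d eps)) \<longlongrightarrow> L) (at_right 0)"
      if j: "j \<in> {1..M} - {i}" for j
    proof -
      obtain L where L: "L \<ge> 0"
        "((\<lambda>eps. ereal (Pij i j eps / Pij i d eps * (tau i eps / tau i eps))) \<longlongrightarrow> L) (at_right 0)"
        using ratio_limit[OF i(1) _ i(2) _ i(3) True] j by blast
      have "((\<lambda>eps. ereal (Pij i j eps / Pij i d eps)) \<longlongrightarrow> L) (at_right 0)"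
        by (rule Lim_transform_eventually[OF L(2)])
          (use tau_pos[OF i(1)] in \<open>eventually_elim, simp\<close>)
      then show ?thesis using L(1) by blast
    qed
    then obtain L where L: "\<And>j. j \<in> {1..M} - {i} \<Longrightarrow> L j \<ge> 0"
      "\<And>j. j \<in> {1..M} - {i} \<Longrightarrow> ((\<lambda>eps. ereal (Pij i j eps / Pij i d eps)) \<longlongrightarrow> L j) (at_right 0)"
      by metis
    show ?thesis
    proof (cases "\<exists>j\<in>{1..M} - {i}. L j = \<infinity>")
      case True
      then obtain j where j: "j \<in> {1..M} - {i}" "L j = \<infinity>" by blast
      have "filterlim (\<lambda>eps. Pij i j eps / Pij i d eps) at_top (at_right 0)"
        using L(2)[OF j(1)] j(2) by (simp add: tendsto_PInfty_eq_at_top)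
      then have inv: "((\<lambda>eps. inverse (Pij i j eps / Pij i d eps)) \<longlongrightarrow> 0) (at_right 0)"
        by (rule tendsto_inverse_0_at_top)
      have large: "\<forall>\<^sub>F eps in at_right 0. 0 < Pij i j eps / Pij i d eps"
        using \<open>filterlim _ at_top _\<close> by (auto simp: filterlim_at_top_dense)
      have "\<forall>\<^sub>F eps in at_right 0. Pij i j eps \<le> 1"
        using j(1) by (intro Pij_le_1[OF i(1)]) auto
      \<comment> \<open>\<open>Pij i d\<close> is the numerator \<open>Pij i j\<close>, at most one,
        divided by the ratio; a ratio tending to infinity therefore forces \<open>Pij i d\<close> to
        0.\<close>
      with large Pij_pos[OF i(1,2) \<open>posTrans Q S i d\<close>]
      have upper: "\<forall>\<^sub>F eps in at_right 0. Pij i d eps \<le> inverse (Pij i j eps / Pij i d eps)"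
      proof eventually_elim
        case (elim eps)
        have "0 < Pij i j eps" using elim by (simp add: zero_less_divide_iff)
        then show ?case using elim j(1) mult_left_le_one_le[of "Pij i d eps" "Pij i j eps"]
          by (simp add: field_simps)
      qed
      have "(Pij i d \<longlongrightarrow> 0) (at_right 0)"
        by (rule tendsto_sandwich[OF Pij_nonneg[OF i] upper tendsto_const inv])
      then show ?thesis by blast
    next
      case False
      define l where "l j = real_of_ereal (L j)" for j
      have l: "((\<lambda>eps. Pij i j eps / Pij i d eps) \<longlongrightarrow> l j) (at_right 0)" if "j \<in> {1..M} - {i}" for j
      proof -
        have "L j = ereal (l j)"
          using False L(1)[OF that] that unfolding l_def by (cases "L j") auto
        then show ?thesis using L(2)[OF that] by simp
      qed
      have "((\<lambda>eps. \<Sum>j\<in>{1..M} - {i}. Pij i j eps / Pij i d eps) \<longlongrightarrow> (\<Sum>j\<in>{1..M} - {i}. l j)) (at_right 0)"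
        by (intro tendsto_sum l)
      then have lim: "((\<lambda>eps. 1 / Pij i d eps) \<longlongrightarrow> (\<Sum>j\<in>{1..M} - {i}. l j)) (at_right 0)"
        by (rule Lim_transform_eventually)
          (use eventually_at_right_0_pos in \<open>eventually_elim, simp only: Pij_sum[OF i(1)] sum_divide_distrib[symmetric]\<close>)
      \<comment> \<open>As \<open>Pij i d\<close> is at most one, the limit of its reciprocal is at
        least one, hence nonzero, and can be inverted.\<close>
      have "1 \<le> (\<Sum>j\<in>{1..M} - {i}. l j)"
      proof (rule tendsto_lowerbound[OF lim])
        show "\<forall>\<^sub>F eps in at_right 0. 1 \<le> 1 / Pij i d eps"
          using Pij_pos[OF i(1,2) \<open>posTrans Q S i d\<close>] Pij_le_1[OF i] by eventually_elim simp
      qed simp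
      then have "((\<lambda>eps. inverse (1 / Pij i d eps)) \<longlongrightarrow> inverse (\<Sum>j\<in>{1..M} - {i}. l j)) (at_right 0)"
        using lim by (intro tendsto_inverse) auto
      then show ?thesis by auto
    qed
  qed
  then show ?thesis
    unfolding P0_def using tendsto_Lim[OF trivial_limit_at_right_real] by auto
qed

lemma P0_nonneg:
  assumes i: "i \<in> {1..M}" "j \<in> {1..M}" "i \<noteq> j"
  shows "0 \<le> P0 Pij i j"
  by (rule tendsto_lowerbound[OF Pij_tendsto[OF i] Pij_nonneg[OF i]]) simp

lemma P0_sum:
  assumes i: "i \<in> {1..M}"
  shows "(\<Sum>j\<in>{1..M} - {i}. P0 Pij i j) = 1"
proof (rule tendsto_unique[OF trivial_limit_at_right_real])
  show "((\<lambda>eps. \<Sum>j\<in>{1..M} - {i}. Pij i j eps) \<longlongrightarrow> (\<Sum>j\<in>{1..M} - {i}. P0 Pij i j)) (at_right 0)"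
    using i by (intro tendsto_sum Pij_tendsto) auto
  show "((\<lambda>eps. \<Sum>j\<in>{1..M} - {i}. Pij i j eps) \<longlongrightarrow> 1) (at_right 0)"
    by (rule Lim_transform_eventually[OF tendsto_const])
      (rule eventually_mono[OF eventually_at_right_0_pos], rule Pij_sum[OF i, symmetric])
qed

text \<open>Half of \<open>e\<close> pays for the convergence of \<open>Pij\<close> to
  \<open>P0\<close>, the other half for the relative error of \<open>Pk\<close>, which is also an
  absolute error because \<open>Pij\<close> is at most one.\<close>

lemma Pk_ge:
  assumes i: "i \<in> {1..M}" "j \<in> {1..M}" "i \<noteq> j" and e: "0 < e"
  shows "\<forall>\<^sub>F eps in at_right 0. \<forall>x\<in>S i. P0 Pij i j - e \<le> Pk Q eps x (S j)"
proof (cases "posTrans Q S i j")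
  case False
  have "P0 Pij i j = 0"
    by (rule tendsto_unique[OF trivial_limit_at_right_real Pij_tendsto[OF i]])
      (rule Lim_transform_eventually[OF tendsto_const],
        use eventually_at_right_0_pos in \<open>eventually_elim, simp add: Pij_zero[OF i False]\<close>)
  then show ?thesis using e by (simp add: Pk_def order_trans[OF _ measure_nonneg])
next
  case True
  have "\<forall>\<^sub>F eps in at_right 0. \<forall>x\<in>S i. dist (Pk Q eps x (S j) / Pij i j eps) 1 < e / 2"
    using uniform_limitD[OF Pij_asym[OF i True], of "e / 2"] e by simp
  moreover have "\<forall>\<^sub>F eps in at_right 0. P0 Pij i j - e / 2 < Pij i j eps"
    using Pij_tendsto[OF i] e by (intro order_tendstoD) auto
  ultimately show ?thesis
    using Pij_pos[OF i(1,2) True] Pij_le_1[OF i]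
  proof eventually_elim
    case (elim eps)
    show ?case
    proof
      fix x assume "x \<in> S i"
      then have "dist (Pk Q eps x (S j) / Pij i j eps) 1 < e / 2"
        using elim by blast
      then have "1 - e / 2 < Pk Q eps x (S j) / Pij i j eps"
        unfolding dist_real_def by linarith
      then have "Pij i j eps - e / 2 * Pij i j eps < Pk Q eps x (S j)"
        using elim by (simp add: field_simps)
      moreover have "e / 2 * Pij i j eps \<le> e / 2"
        using elim e by (intro mult_left_le) auto
      ultimately show "P0 Pij i j - e \<le> Pk Q eps x (S j)" using elim by linarith
    qed
  qed
qed

section \<open>Holding times compared with the time scale\<close>

text \<open>A crude constant suffices: the bound feeds Markov's inequality for fast states and
  tightness for slow ones.\<close>

lemma condT_mean_le:
  assumes i: "i \<in> {1..M}" "j \<in> {1..M}" "posTrans Q S i j"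
  shows "\<forall>\<^sub>F eps in at_right 0. \<forall>x\<in>S i. (\<integral>s. s \<partial>condT Q eps x (S j)) \<le> 2 * tau i eps"
proof -
  have "\<forall>\<^sub>F eps in at_right 0. \<forall>x\<in>S i. dist ((\<integral>s. s \<partial>condT Q eps x (S j)) / tau i eps) 1 < 1"
    using uniform_limitD[OF mean[OF i], of 1] by simp
  with tau_pos[OF i(1)] show ?thesis
  proof eventually_elim
    case (elim eps)
    show ?case
    proof
      fix x assume "x \<in> S i"
      then have "(\<integral>s. s \<partial>condT Q eps x (S j)) / tau i eps < 2"
        using elim by (force simp: dist_real_def)
      then show "(\<integral>s. s \<partial>condT Q eps x (S j)) \<le> 2 * tau i eps"
        using elim by (simp add: field_simps)
    qed
  qed
qed

text \<open>There are at most \<open>M\<close> targets, so a bound \<open>e / (2 * M)\<close> for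
  each conditional law sums to at most \<open>e / 2\<close>.\<close>

lemma measure_time_small:
  assumes i: "i \<in> {1..M}" and I: "\<And>eps. I eps \<in> sets borel" and e: "0 < e"
    and small: "\<And>j e. j \<in> {1..M} \<Longrightarrow> posTrans Q S i j \<Longrightarrow> 0 < e \<Longrightarrow>
      \<forall>\<^sub>F eps in at_right 0. \<forall>x\<in>S i. measure (condT Q eps x (S j)) (I eps) < e"
  shows "\<forall>\<^sub>F eps in at_right 0. \<forall>x\<in>S i. measure (Q eps x) (UNIV \<times> I eps) < e"
proof -
  have M: "0 < real M" using i by auto
  have "\<forall>\<^sub>F eps in at_right 0. \<forall>j\<in>{j\<in>{1..M}. posTrans Q S i j}.
      \<forall>x\<in>S i. measure (condT Q eps x (S j)) (I eps) < e / (2 * M)"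
    using M e by (intro eventually_ball_finite ballI small) auto
  with eventually_at_right_0_pos show ?thesis
  proof eventually_elim
    case (elim eps)
    show ?case
    proof
      fix x assume x: "x \<in> S i"
      have "measure (Q eps x) (UNIV \<times> I eps) \<le>
        (\<Sum>j | j \<in> {1..M} \<and> 0 < Pk Q eps x (S j). measure (condT Q eps x (S j)) (I eps))"
        using elim by (intro measure_le_sum_condT kernel S_disj S_cover S_meas I) auto
      also have "\<dots> \<le> (\<Sum>j | j \<in> {1..M} \<and> 0 < Pk Q eps x (S j). e / (2 * M))"
      proof (intro sum_mono)
        fix j assume j: "j \<in> {j \<in> {1..M}. 0 < Pk Q eps x (S j)}"
        \<comment> \<open>Positivity of \<open>Pk\<close> at a single \<open>x\<close> and
          \<open>eps\<close> excludes the first case of the dichotomy.\<close>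
        then have "i \<noteq> j" using noself[OF i elim(1) x] by auto
        then have "posTrans Q S i j" using dichotomy[OF i, of j] j elim x by force
        then show "measure (condT Q eps x (S j)) (I eps) \<le> e / (2 * M)"
          using elim x j by force
      qed
      also have "\<dots> \<le> (\<Sum>j\<in>{1..M}. e / (2 * M))"
        using e by (intro sum_mono2) auto
      also have "\<dots> < e" using M e by simp
      finally show "measure (Q eps x) (UNIV \<times> I eps) < e" .
    qed
  qed
qed

text \<open>Markov's inequality bounds the tail by \<open>2 * tau i eps / (c * t eps)\<close>, which
  explains the threshold \<open>e * c / 2\<close> for the ratio of \<open>tau i\<close> to
  \<open>t\<close>.\<close>

lemma measure_time_gt_small:
  assumes i: "i \<in> {1..M}" and t: "\<And>eps. 0 < eps \<Longrightarrow> 0 < t eps" and fast: "llt (tau i) t"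
    and c: "0 < c" and e: "0 < e"
  shows "\<forall>\<^sub>F eps in at_right 0. \<forall>x\<in>S i. measure (Q eps x) (UNIV \<times> {c * t eps<..}) < e"
proof (rule measure_time_small[OF i _ e])
  fix j and e :: real assume j: "j \<in> {1..M}" "posTrans Q S i j" and e: "0 < e"
  have "\<forall>\<^sub>F eps in at_right 0. tau i eps / t eps < e * c / 2"
    using fast c e unfolding llt_def by (intro order_tendstoD) auto
  with eventually_at_right_0_pos condT_mean_le[OF i j] integrable[OF i j]
  show "\<forall>\<^sub>F eps in at_right 0. \<forall>x\<in>S i. measure (condT Q eps x (S j)) {c * t eps<..} < e"
  proof eventually_elim
    case (elim eps)
    show ?case
    proof
      fix x assume x: "x \<in> S i"
      interpret prob_space "condT Q eps x (S j)"
        using elim j x by (intro prob_space_condT kernel S_meas posTransD)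
      have ct: "0 < c * t eps" using c t elim by simp
      have "measure (condT Q eps x (S j)) {c * t eps<..} \<le> measure (condT Q eps x (S j)) {s \<in> space (condT Q eps x (S j)). c * t eps \<le> s}"
        by (intro finite_measure_mono) (auto simp: atLeast_def[symmetric])
      also have "\<dots> \<le> (\<integral>s. s \<partial>condT Q eps x (S j)) / (c * t eps)"
        using elim x j ct
        by (intro integral_Markov_inequality_measure[where A = "{}"] AE_condT_nonneg kernel S_meas posTransD times_nonneg) auto
      also have "\<dots> \<le> 2 * tau i eps / (c * t eps)"
        using elim x ct by (intro divide_right_mono) auto
      also have "\<dots> < e"
        using elim c t[OF elim(1)] by (simp add: field_simps)
      finally show "measure (condT Q eps x (S j)) {c * t eps<..} < e" .
    qed
  qed
qed simp

text \<open>Absence of atoms is assumed along sequences of points, while the claim is uniform in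
  \<open>x\<close>; a sequence of bad points bridges the gap. After division by \<open>tau i\<close>
  the means are at most 2 and the threshold \<open>t / tau i\<close> tends to 0, so
  \<open>measure_atMost_tendsto_0\<close> applies.\<close>

lemma measure_time_le_small:
  assumes i: "i \<in> {1..M}" and slow: "llt t (tau i)" and e: "0 < e"
  shows "\<forall>\<^sub>F eps in at_right 0. \<forall>x\<in>S i. measure (Q eps x) (UNIV \<times> {..t eps}) < e"
proof (rule measure_time_small[OF i _ e])
  fix j and e :: real assume j: "j \<in> {1..M}" "posTrans Q S i j" and e: "0 < e"
  have "\<forall>\<^sub>F eps in at_right 0. 0 < tau i eps \<and>
    (\<forall>x\<in>S i. integrable (condT Q eps x (S j)) (\<lambda>s. s) \<and> (\<integral>s. s \<partial>condT Q eps x (S j)) \<le> 2 * tau i eps)"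
    using tau_pos[OF i] condT_mean_le[OF i j] integrable[OF i j] by eventually_elim auto
  then obtain b :: real where b: "0 < b"
    and good: "\<And>eps. 0 < eps \<Longrightarrow> eps < b \<Longrightarrow> 0 < tau i eps \<and>
    (\<forall>x\<in>S i. integrable (condT Q eps x (S j)) (\<lambda>s. s) \<and> (\<integral>s. s \<partial>condT Q eps x (S j)) \<le> 2 * tau i eps)"
    unfolding eventually_at_right_field by auto
  show "\<forall>\<^sub>F eps in at_right 0. \<forall>x\<in>S i. measure (condT Q eps x (S j)) {..t eps} < e"
  proof (rule sequentially_imp_eventually_at_right[OF b])
    fix f :: "nat \<Rightarrow> real"
    assume f: "\<And>n. 0 < f n" "\<And>n. f n < b" "decseq f" "f \<longlonglongrightarrow> 0"
    \<comment> \<open>The chosen point violates the bound whenever some point of \<open>S i\<close>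
      does; smallness there thus means smallness everywhere on \<open>S i\<close>.\<close>
    have "\<exists>x. x \<in> S i \<and> (measure (condT Q (f n) x (S j)) {..t (f n)} < e \<longrightarrow>
      (\<forall>x\<in>S i. measure (condT Q (f n) x (S j)) {..t (f n)} < e))" for n
      using S_nonempty[OF i] by blast
    then obtain xs where "\<forall>n. xs n \<in> S i \<and> (measure (condT Q (f n) (xs n) (S j)) {..t (f n)} < e \<longrightarrow>
      (\<forall>x\<in>S i. measure (condT Q (f n) x (S j)) {..t (f n)} < e))"
      using choice[of "\<lambda>n x. x \<in> S i \<and> (measure (condT Q (f n) x (S j)) {..t (f n)} < e \<longrightarrow>
        (\<forall>x\<in>S i. measure (condT Q (f n) x (S j)) {..t (f n)} < e))"] by auto
    then have xs: "\<And>n. xs n \<in> S i"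
      "\<And>n. measure (condT Q (f n) (xs n) (S j)) {..t (f n)} < e \<Longrightarrow>
        (\<forall>x\<in>S i. measure (condT Q (f n) x (S j)) {..t (f n)} < e)"
      by auto
    define \<mu> where "\<mu> n = distr (condT Q (f n) (xs n) (S j)) borel (\<lambda>s. s / tau i (f n))" for n
    define a where "a n = t (f n) / tau i (f n)" for n
    have tau: "0 < tau i (f n)" for n using good[OF f(1,2)] by blast
    have ps: "prob_space (condT Q (f n) (xs n) (S j))" for n
      using f(1) j xs by (intro prob_space_condT kernel S_meas posTransD)
    have meas: "(\<lambda>s. s / tau i (f n)) \<in> condT Q (f n) (xs n) (S j) \<rightarrow>\<^sub>M borel" for n
      by (simp add: measurable_cong_sets[OF sets_condT refl])
    have "(\<lambda>n. measure (\<mu> n) {..a n}) \<longlonglongrightarrow> 0"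
    proof (rule measure_atMost_tendsto_0[where m = 2])
      show "real_distribution (\<mu> n)" for n
        unfolding \<mu>_def by (rule prob_space.real_distribution_distr[OF ps meas])
      show "AE x in \<mu> n. 0 \<le> x" for n
      proof -
        have "AE s in condT Q (f n) (xs n) (S j). 0 \<le> s"
          using f j xs by (intro AE_condT_nonneg kernel S_meas posTransD times_nonneg)
        then have "AE s in condT Q (f n) (xs n) (S j). 0 \<le> s / tau i (f n)"
          using tau[of n] by (auto elim!: eventually_mono)
        then show ?thesis
          unfolding \<mu>_def by (subst AE_distr_iff[OF meas]) auto
      qed
      show "integrable (\<mu> n) (\<lambda>x. x)" for n
        unfolding \<mu>_def using good[OF f(1,2), of n] xs(1)[of n] by (subst integrable_distr_eq[OF meas]) auto
      show "(\<integral>x. x \<partial>\<mu> n) \<le> 2" for n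
        unfolding \<mu>_def using good[OF f(1,2), of n] xs(1)[of n]
        by (subst integral_distr[OF meas]) (auto simp: field_simps)
      have lim0: "filterlim f (at_right 0) sequentially"
        using f(4) by (simp add: filterlim_at f(1) less_imp_neq[OF f(1), THEN not_sym])
      show "a \<longlonglongrightarrow> 0"
        unfolding a_def using filterlim_compose[OF slow[unfolded llt_def] lim0] .
    next
      fix r :: "nat \<Rightarrow> nat" and \<xi> y
      assume r: "strict_mono r" and \<xi>: "real_distribution \<xi>" "weak_conv_m (\<lambda>n. \<mu> (r n)) \<xi>"
      show "measure \<xi> {y} = 0"
      proof (rule noatoms[OF i j, of "\<lambda>n. xs (r n)" "\<lambda>n. f (r n)"])
        show "decseq (\<lambda>n. f (r n))"
          using f(3) r by (simp add: decseq_def strict_mono_less_eq)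
        show "(\<lambda>n. f (r n)) \<longlonglongrightarrow> 0"
          using LIMSEQ_subseq_LIMSEQ[OF f(4) r] by (simp add: comp_def)
      qed (use xs f \<xi> in \<open>auto simp: \<mu>_def\<close>)
    qed
    then have "\<forall>\<^sub>F n in sequentially. measure (\<mu> n) {..a n} < e"
      using e by (rule order_tendstoD)
    then show "\<forall>\<^sub>F n in sequentially. \<forall>x\<in>S i. measure (condT Q (f n) x (S j)) {..t (f n)} < e"
    proof eventually_elim
      case (elim n)
      have "measure (\<mu> n) {..a n} = measure (condT Q (f n) (xs n) (S j)) {..t (f n)}"
        unfolding \<mu>_def using tau[of n]
        by (subst measure_distr[OF meas]) (auto intro!: arg_cong[where f = "measure _"] simp: a_def field_simps)
      then show ?case using elim xs(2) by auto
    qed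
  qed
qed simp

section \<open>Lower bounds by hitting probabilities of the limiting chain\<close>

text \<open>After a jump the residual time is random, so the induction carries uniformity in
  \<open>u\<close> over a window. Its lower end is governed by \<open>t1\<close>, against which
  states of \<open>C - D\<close> are fast, and its upper end by \<open>t2\<close>, against which
  states of \<open>D\<close> are slow. Both \<open>c\<close> and \<open>e\<close> vary because each
  step halves them.\<close>

lemma semiMarkovProb_ge_hit_within:
  assumes C: "C \<subseteq> {1..M}" "D \<subseteq> C"
    and P0_sum_C: "\<And>i. i \<in> C \<Longrightarrow> (\<Sum>k\<in>C - {i}. P0 Pij i k) = 1"
    and t1: "\<And>eps. 0 < eps \<Longrightarrow> 0 < t1 eps"
    and fast: "\<And>i. i \<in> C - D \<Longrightarrow> llt (tau i) t1" and slow: "\<And>i. i \<in> D \<Longrightarrow> llt t2 (tau i)"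
    and j: "j \<in> {1..M}" and c: "0 < c" and e: "0 < e"
  shows "\<forall>\<^sub>F eps in at_right 0. \<forall>i\<in>C. \<forall>x\<in>S i. \<forall>u. c * t1 eps \<le> u \<longrightarrow> u \<le> t2 eps \<longrightarrow>
    hit_within (P0 Pij) C D n i j - e \<le> semiMarkovProb Q eps x u (S j)"
proof -
  have finC: "finite C" using C(1) by (rule finite_subset) simp
  have finD: "finite D" using C(2) finC by (rule finite_subset)
  have P0_nn: "0 \<le> P0 Pij i k" if "i \<in> C" "k \<in> C" "i \<noteq> k" for i k
    using that C(1) by (intro P0_nonneg) auto
  have hit_le_1: "hit_within (P0 Pij) C D n i j \<le> 1" if "i \<in> C" for n i
    using that by (intro hit_within_le_1[OF finC C(2)] P0_nn P0_sum_C)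
  \<comment> \<open>From a state of \<open>D\<close> the process has not moved by time
    \<open>t2 eps\<close>, up to probability \<open>e\<close>; this settles \<open>i\<close> in
    \<open>D\<close> for every \<open>n\<close>.\<close>
  have slow_bound: "\<forall>\<^sub>F eps in at_right 0. \<forall>i\<in>D. \<forall>x\<in>S i. \<forall>u. c * t1 eps \<le> u \<longrightarrow> u \<le> t2 eps \<longrightarrow>
    (if i = j then 1 else 0) - e \<le> semiMarkovProb Q eps x u (S j)" if c: "0 < c" and e: "0 < e" for c e
  proof (intro eventually_ball_finite[OF finD] ballI)
    fix i assume i: "i \<in> D"
    then have iM: "i \<in> {1..M}" using C by blast
    show "\<forall>\<^sub>F eps in at_right 0. \<forall>x\<in>S i. \<forall>u. c * t1 eps \<le> u \<longrightarrow> u \<le> t2 eps \<longrightarrow>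
      (if i = j then 1 else 0) - e \<le> semiMarkovProb Q eps x u (S j)"
      using eventually_at_right_0_pos measure_time_le_small[OF iM slow[OF i] e]
    proof eventually_elim
      case (elim eps)
      show ?case
      proof (intro ballI allI impI)
        fix x u assume x: "x \<in> S i" and u: "c * t1 eps \<le> u" "u \<le> t2 eps"
        show "(if i = j then 1 else 0) - e \<le> semiMarkovProb Q eps x u (S j)"
        proof (cases "i = j")
          case False
          then show ?thesis using e semiMarkovProb_nonneg[OF kernel times_nonneg] elim
            by (simp add: order_trans[of "-e" 0])
        next
          case True
          interpret Qx: prob_space "Q eps x" by (rule kernel_prob_space[OF kernel[OF elim(1)]])
          have rect: "UNIV \<times> I \<in> sets (Q eps x)" if "I \<in> sets borel" for I
            unfolding sets_kernel[OF kernel[OF elim(1)]] using that by (intro pair_measureI) auto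
          have "UNIV \<times> {..u} \<union> UNIV \<times> {u<..} = space (Q eps x)"
            by (auto simp: space_kernel[OF kernel[OF elim(1)]])
          then have "1 = measure (Q eps x) (UNIV \<times> {..u} \<union> UNIV \<times> {u<..})"
            using Qx.prob_space by simp
          also have "\<dots> \<le> measure (Q eps x) (UNIV \<times> {..u}) + measure (Q eps x) (UNIV \<times> {u<..})"
            by (intro measure_Un_le rect) auto
          also have "measure (Q eps x) (UNIV \<times> {..u}) \<le> measure (Q eps x) (UNIV \<times> {..t2 eps})"
            using u by (intro Qx.finite_measure_mono rect) auto
          also have "measure (Q eps x) (UNIV \<times> {..t2 eps}) \<le> e"
            using elim(2) x by (simp add: less_imp_le)
          also have "measure (Q eps x) (UNIV \<times> {u<..}) \<le> semiMarkovProb Q eps x u (S j)"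
          proof (rule semiMarkovProb_ge_stay[OF kernel times_nonneg S_meas])
            show "x \<in> S j" using x True by simp
            have "0 < c * t1 eps" using c t1[OF elim(1)] by simp
            then show "0 \<le> u" using u by linarith
          qed (rule elim(1) j)+
          finally show ?thesis using True by simp
        qed
      qed
    qed
  qed
  show ?thesis
    using c e
  proof (induction n arbitrary: c e)
    case (0 c e)
    show ?case
      using eventually_at_right_0_pos slow_bound[OF 0]
    proof eventually_elim
      case (elim eps)
      show ?case
      proof (intro ballI allI impI)
        fix i x u assume *: "i \<in> C" "x \<in> S i" "c * t1 eps \<le> u" "u \<le> t2 eps"
        show "hit_within (P0 Pij) C D 0 i j - e \<le> semiMarkovProb Q eps x u (S j)"
        proof (cases "i \<in> D")
          case True
          then show ?thesis using elim * by simp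
        next
          case False
          then show ?thesis using 0 semiMarkovProb_nonneg[OF kernel times_nonneg] elim
            by (simp add: order_trans[of "-e" 0])
        qed
      qed
    qed
  next
    case (Suc n c e)
    \<comment> \<open>Each target costs \<open>2 * \<delta>\<close>, in total at most
      \<open>e / 2\<close>; the other half of \<open>e\<close> is the error of the induction
      hypothesis.\<close>
    define \<delta> where "\<delta> = e / (4 * (card C + 1))"
    have \<delta>: "0 < \<delta>" "2 * \<delta> * card C \<le> e / 2"
      using Suc.prems by (auto simp: \<delta>_def field_simps)
    have IH: "\<forall>\<^sub>F eps in at_right 0. \<forall>i\<in>C. \<forall>x\<in>S i. \<forall>u. c / 2 * t1 eps \<le> u \<longrightarrow> u \<le> t2 eps \<longrightarrow>
      hit_within (P0 Pij) C D n i j - e / 2 \<le> semiMarkovProb Q eps x u (S j)"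
      using Suc.prems by (intro Suc.IH) auto
    have Pk: "\<forall>\<^sub>F eps in at_right 0. \<forall>i\<in>C. \<forall>k\<in>C - {i}. \<forall>x\<in>S i. P0 Pij i k - \<delta> \<le> Pk Q eps x (S k)"
      using C(1) \<delta> finC by (intro eventually_ball_finite ballI Pk_ge) auto
    have time: "\<forall>\<^sub>F eps in at_right 0. \<forall>i\<in>C - D. \<forall>x\<in>S i. measure (Q eps x) (UNIV \<times> {c / 2 * t1 eps<..}) < \<delta>"
      using C(1) \<delta> finC Suc.prems
      by (intro eventually_ball_finite ballI measure_time_gt_small t1 fast) auto
    show ?case
      using eventually_at_right_0_pos slow_bound[OF Suc.prems] IH Pk time
    proof eventually_elim
      case (elim eps)
      show ?case
      proof (intro ballI allI impI)
        fix i x u assume *: "i \<in> C" "x \<in> S i" "c * t1 eps \<le> u" "u \<le> t2 eps"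
        show "hit_within (P0 Pij) C D (Suc n) i j - e \<le> semiMarkovProb Q eps x u (S j)"
        proof (cases "i \<in> D")
          case True
          then show ?thesis using elim(2) * by simp
        next
          case False
          let ?h = "\<lambda>k. hit_within (P0 Pij) C D n k j"
          let ?m = "measure (Q eps x) (UNIV \<times> {c / 2 * t1 eps<..})"
          \<comment> \<open>Truncation at 0 supplies the nonnegative bounds required by
            \<open>semiMarkovProb_ge_step\<close>.\<close>
          define b where "b k = max 0 (?h k - e / 2)" for k
          have b: "0 \<le> b k" "b k \<le> 1" "?h k - e / 2 \<le> b k" if "k \<in> C" for k
            using hit_le_1[OF that, of n] Suc.prems by (auto simp: b_def)
          have m: "?m \<le> \<delta>" using elim(5) * False by (simp add: less_imp_le)
          \<comment> \<open>One \<open>\<delta>\<close> is the error of the transition probability,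
            the other the probability of a late jump; \<open>b k\<close> at most one keeps their
            weight bounded.\<close>
          have term_le: "P0 Pij i k * (?h k - e / 2) - 2 * \<delta> \<le> b k * (Pk Q eps x (S k) - ?m)"
            if k: "k \<in> C - {i}" for k
          proof -
            have "P0 Pij i k - 2 * \<delta> \<le> Pk Q eps x (S k) - ?m"
            proof -
              have "P0 Pij i k - \<delta> \<le> Pk Q eps x (S k)" using elim(4) * k by blast
              then show ?thesis using m by linarith
            qed
            then have "b k * (P0 Pij i k - 2 * \<delta>) \<le> b k * (Pk Q eps x (S k) - ?m)"
              using b k by (intro mult_left_mono) auto
            moreover have "P0 Pij i k * (?h k - e / 2) \<le> P0 Pij i k * b k"
              using b k * by (intro mult_left_mono P0_nn) auto
            moreover have "b k * (2 * \<delta>) \<le> 2 * \<delta>"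
              using b[of k] k \<delta> by (intro mult_left_le_one_le) auto
            ultimately show ?thesis by (simp add: algebra_simps)
          qed
          have "real (card (C - {i})) \<le> real (card C)"
            using finC by (simp add: card_mono)
          then have "2 * \<delta> * real (card (C - {i})) \<le> 2 * \<delta> * real (card C)"
            using \<delta> by (intro mult_left_mono) auto
          then have "(\<Sum>k\<in>C - {i}. P0 Pij i k * ?h k) - e \<le>
            (\<Sum>k\<in>C - {i}. P0 Pij i k * ?h k) - e / 2 * (\<Sum>k\<in>C - {i}. P0 Pij i k) - 2 * \<delta> * card (C - {i})"
            using P0_sum_C[OF *(1)] \<delta>(2) by simp
          also have "\<dots> = (\<Sum>k\<in>C - {i}. P0 Pij i k * (?h k - e / 2) - 2 * \<delta>)"
            by (simp add: sum_subtractf right_diff_distrib sum_distrib_left mult.commute)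
          also have "\<dots> \<le> (\<Sum>k\<in>C - {i}. b k * (Pk Q eps x (S k) - ?m))"
            by (intro sum_mono term_le)
          also have "\<dots> \<le> semiMarkovProb Q eps x u (S j)"
          proof (rule semiMarkovProb_ge_step[OF kernel times_nonneg S_meas])
            show "disjoint_family_on S (C - {i})"
              using S_disj C(1) by (auto intro: disjoint_family_on_mono)
            show "finite (C - {i})" using finC by simp
            show "S k \<in> sets borel" "0 \<le> b k" if "k \<in> C - {i}" for k
              using that C(1) b(1) by (auto intro!: S_meas)
            fix k z v assume kzv: "k \<in> C - {i}" "z \<in> S k" "u - c / 2 * t1 eps \<le> v" "v \<le> u"
            \<comment> \<open>The jump used at most \<open>c / 2 * t1 eps\<close> out of at least
              \<open>c * t1 eps\<close>.\<close>
            have "c / 2 * t1 eps \<le> v" "v \<le> t2 eps" using kzv * by auto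
            then have "?h k - e / 2 \<le> semiMarkovProb Q eps z v (S j)"
              using elim(3) kzv by blast
            then show "b k \<le> semiMarkovProb Q eps z v (S j)"
              using semiMarkovProb_nonneg[OF kernel times_nonneg] elim(1) by (simp add: b_def)
          qed (rule elim(1) j)+
          finally show ?thesis using False by simp
        qed
      qed
    qed
  qed
qed

section \<open>Convergence within an ergodic class\<close>

lemma ergodic_P0_sum:
  assumes erg: "ergodic_class (P0 Pij) M C" and i: "i \<in> C"
  shows "(\<Sum>k\<in>C - {i}. P0 Pij i k) = 1"
proof -
  have C: "C \<subseteq> {1..M}" using erg by (simp add: ergodic_class_def)
  have "(\<Sum>k\<in>C - {i}. P0 Pij i k) = (\<Sum>k\<in>{1..M} - {i}. P0 Pij i k)"
    using erg C i by (intro sum.mono_neutral_left) (auto simp: ergodic_class_def)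
  then show ?thesis using P0_sum[of i] C i by auto
qed

text \<open>Closedness of the class keeps every positive-probability path that starts in
  \<open>C\<close> inside \<open>C\<close>.\<close>

lemma ergodic_reach:
  assumes erg: "ergodic_class (P0 Pij) M C" and i: "i \<in> C" "d \<in> C"
  shows "(i, d) \<in> {(a, b). a \<in> C \<and> b \<in> C \<and> 0 < P0 Pij a b}\<^sup>*"
proof -
  have "(i, d) \<in> {(a, b). a \<in> {1..M} \<and> b \<in> {1..M} \<and> 0 < P0 Pij a b}\<^sup>*"
    using erg i by (auto simp: ergodic_class_def)
  then have "d \<in> C \<and> (i, d) \<in> {(a, b). a \<in> C \<and> b \<in> C \<and> 0 < P0 Pij a b}\<^sup>*"
  proof (induction rule: rtrancl_induct)
    case base
    then show ?case using i by simp
  next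
    case (step y z)
    have "z \<in> C" using step erg by (force simp: ergodic_class_def)
    then show ?case using step by (auto intro: rtrancl_into_rtrancl)
  qed
  then show ?thesis by blast
qed

text \<open>Lower bounds for all states whose limits sum to one leave no room for any single state
  to exceed its limit. The supremum over the window is taken at each fixed \<open>eps\<close>, which
  later yields uniformity over time scales.\<close>

lemma metastable_limit:
  assumes erg: "ergodic_class (P0 Pij) M C" and D: "D \<subseteq> C" "D \<noteq> {}"
    and t1: "\<And>eps. 0 < eps \<Longrightarrow> 0 < t1 eps"
    and fast: "\<And>i. i \<in> C - D \<Longrightarrow> llt (tau i) t1" and slow: "\<And>i. i \<in> D \<Longrightarrow> llt t2 (tau i)"
    and i: "i \<in> C"
  shows "\<exists>\<mu>. (\<forall>j. 0 \<le> \<mu> j) \<and> (\<forall>j. j \<notin> D \<longrightarrow> \<mu> j = 0) \<and> (\<Sum>j\<in>D. \<mu> j) = 1 \<and>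
    (\<forall>j\<in>{1..M}. \<forall>e>0. \<forall>\<^sub>F eps in at_right 0. \<forall>x\<in>S i. \<forall>u. t1 eps \<le> u \<longrightarrow> u \<le> t2 eps \<longrightarrow>
      \<bar>semiMarkovProb Q eps x u (S j) - \<mu> j\<bar> < e)"
proof -
  have C: "C \<subseteq> {1..M}" using erg by (simp add: ergodic_class_def)
  have finC: "finite C" using C by (rule finite_subset) simp
  have finD: "finite D" using D(1) finC by (rule finite_subset)
  have P0_nn: "0 \<le> P0 Pij i k" if "i \<in> C" "k \<in> C" "i \<noteq> k" for i k
    using that C by (intro P0_nonneg) auto
  have reach: "\<exists>d\<in>D. (i, d) \<in> {(a, b). a \<in> C \<and> b \<in> C \<and> 0 < P0 Pij a b}\<^sup>*" if "i \<in> C" for i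
    using ergodic_reach[OF erg that] D by blast
  obtain \<mu> where \<mu>: "\<And>i j. i \<in> C \<Longrightarrow> (\<lambda>n. hit_within (P0 Pij) C D n i j) \<longlonglongrightarrow> \<mu> i j"
    "\<And>i j. i \<in> C \<Longrightarrow> 0 \<le> \<mu> i j" "\<And>i j. i \<in> C \<Longrightarrow> j \<notin> D \<Longrightarrow> \<mu> i j = 0"
    "\<And>i. i \<in> C \<Longrightarrow> (\<Sum>j\<in>D. \<mu> i j) = 1"
    by (rule hitting_distribution[OF finC D(1), of "P0 Pij"])
      (assumption | rule P0_nn ergodic_P0_sum[OF erg] reach | blast)+
  have "\<forall>\<^sub>F eps in at_right 0. \<forall>x\<in>S i. \<forall>u. t1 eps \<le> u \<longrightarrow> u \<le> t2 eps \<longrightarrow>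
      \<bar>semiMarkovProb Q eps x u (S j) - \<mu> i j\<bar> < e" if j: "j \<in> {1..M}" and e: "0 < e" for j e
  proof -
    \<comment> \<open>The lower bound loses \<open>2 * \<delta>\<close>; the upper bound loses that
      amount for each of the other \<open>M - 1\<close> states.\<close>
    define \<delta> where "\<delta> = e / (4 * (M + 1))"
    have \<delta>: "0 < \<delta>" "2 * \<delta> * M < e" "2 * \<delta> < e"
      using e by (auto simp: \<delta>_def field_simps add_strict_increasing)
    \<comment> \<open>The number \<open>n\<close> of steps is fixed before \<open>eps\<close> tends
      to 0, so no interchange of limits is involved.\<close>
    have "\<forall>\<^sub>F n in sequentially. \<forall>k\<in>{1..M}. \<mu> i k - \<delta> < hit_within (P0 Pij) C D n i k"
      using \<delta> by (intro eventually_ball_finite ballI order_tendstoD[OF \<mu>(1)[OF i]]) auto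
    then obtain n where n: "\<And>k. k \<in> {1..M} \<Longrightarrow> \<mu> i k - \<delta> < hit_within (P0 Pij) C D n i k"
      unfolding eventually_sequentially by blast
    have "\<forall>\<^sub>F eps in at_right 0. \<forall>k\<in>{1..M}. \<forall>i\<in>C. \<forall>x\<in>S i. \<forall>u. 1 * t1 eps \<le> u \<longrightarrow> u \<le> t2 eps \<longrightarrow>
      hit_within (P0 Pij) C D n i k - \<delta> \<le> semiMarkovProb Q eps x u (S k)"
      using \<delta> by (intro eventually_ball_finite ballI semiMarkovProb_ge_hit_within C D ergodic_P0_sum[OF erg] t1 fast slow) auto
    with eventually_at_right_0_pos show ?thesis
    proof eventually_elim
      case (elim eps)
      show ?case
      proof (intro ballI allI impI)
        fix x u assume *: "x \<in> S i" "t1 eps \<le> u" "u \<le> t2 eps"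
        let ?F = "\<lambda>k. semiMarkovProb Q eps x u (S k)"
        have lower: "\<mu> i k - 2 * \<delta> \<le> ?F k" if "k \<in> {1..M}" for k
        proof -
          have "hit_within (P0 Pij) C D n i k - \<delta> \<le> ?F k"
            using elim(2) that i * by auto
          then show ?thesis using n[OF that] by linarith
        qed
        have "?F j + (\<Sum>k\<in>{1..M} - {j}. \<mu> i k - 2 * \<delta>) \<le> ?F j + (\<Sum>k\<in>{1..M} - {j}. ?F k)"
          by (intro add_left_mono sum_mono lower) auto
        also have "\<dots> = (\<Sum>k\<in>{1..M}. ?F k)"
          using j by (simp add: sum.remove)
        also have "\<dots> \<le> 1"
          using elim S_disj by (intro sum_semiMarkovProb_le_1 kernel times_nonneg S_meas) auto
        finally have up: "?F j + (\<Sum>k\<in>{1..M} - {j}. \<mu> i k) - 2 * \<delta> * (M - 1) \<le> 1"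
          using j by (simp add: sum_subtractf mult.commute)
        \<comment> \<open>States outside \<open>D\<close> have limit 0, including those outside the
          class, so the limits over all states still sum to one.\<close>
        have "(\<Sum>k\<in>{1..M}. \<mu> i k) = (\<Sum>k\<in>D. \<mu> i k)"
          using C D \<mu>(3)[OF i] by (intro sum.mono_neutral_right) auto
        then have "\<mu> i j + (\<Sum>k\<in>{1..M} - {j}. \<mu> i k) = 1"
          using \<mu>(4)[OF i] j by (simp add: sum.remove)
        moreover have "2 * \<delta> * (M - 1) \<le> 2 * \<delta> * M"
          using \<delta> by (intro mult_left_mono) auto
        ultimately show "\<bar>?F j - \<mu> i j\<bar> < e"
          using up lower[OF j] \<delta> by (simp only: abs_less_iff) linarith
      qed
    qed
  qed
  then show ?thesis using \<mu>(2-4)[OF i] by (intro exI[of _ "\<mu> i"]) auto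
qed

end

section \<open>Limits at one time scale and over a window of time scales\<close>

theorem theorem7p5:
  fixes Q :: "real \<Rightarrow> 'a::metric_space \<Rightarrow> ('a \<times> real) measure"
    and S :: "nat \<Rightarrow> 'a set"
    and M M' :: nat
    and Pij :: "nat \<Rightarrow> nat \<Rightarrow> real \<Rightarrow> real"
    and tau :: "nat \<Rightarrow> real \<Rightarrow> real"
  assumes kernel: "\<forall>eps>0. Q eps \<in> borel \<rightarrow>\<^sub>M prob_algebra SP"
    and times_nonneg: "\<forall>eps>0. \<forall>x. emeasure (Q eps x) (UNIV \<times> {..<0}) = 0"
    and S_meas: "\<forall>i\<in>{1..M}. S i \<in> sets borel"
    and S_disj: "disjoint_family_on S {1..M}"
    and S_cover: "(\<Union>i\<in>{1..M}. S i) = UNIV"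
    and a_noself: "\<forall>i\<in>{1..M}. \<forall>eps>0. \<forall>x\<in>S i. Pk Q eps x (S i) = 0"
    and a_dich: "\<forall>i\<in>{1..M}. \<forall>j\<in>{1..M}. i \<noteq> j \<longrightarrow>
        (\<forall>eps>0. \<forall>x\<in>S i. Pk Q eps x (S j) = 0) \<or> posTrans Q S i j"
    and a_asym: "\<forall>i\<in>{1..M}. \<forall>j\<in>{1..M}. i \<noteq> j \<longrightarrow> posTrans Q S i j \<longrightarrow>
        uniform_limit (S i) (\<lambda>eps x. Pk Q eps x (S j) / Pij i j eps) (\<lambda>_. 1) (at_right 0)"
    and a_zero: "\<forall>i\<in>{1..M}. \<forall>j\<in>{1..M}. i \<noteq> j \<longrightarrow> \<not> posTrans Q S i j \<longrightarrow>
        (\<forall>eps>0. Pij i j eps = 0)"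
    and a_sum: "\<forall>i\<in>{1..M}. \<forall>eps>0. (\<Sum>j\<in>{1..M} - {i}. Pij i j eps) = 1"
    and a_conn: "\<forall>i\<in>{1..M}. \<forall>j\<in>{1..M}. i \<noteq> j \<longrightarrow>
        (\<exists>(k::nat) (p::nat \<Rightarrow> nat). p 0 = i \<and> p k = j \<and>
           (\<forall>r<k. p r \<in> {1..M} \<and> (\<forall>eps>0. Pij (p r) (p (Suc r)) eps > 0)))"
    and b_mean: "\<forall>i\<in>{1..M}. \<forall>j\<in>{1..M}. posTrans Q S i j \<longrightarrow>
        uniform_limit (S i) (\<lambda>eps x. (\<integral>s. s \<partial>condT Q eps x (S j)) / tau i eps) (\<lambda>_. 1) (at_right 0)"
    and c_var: "\<exists>C eps0. C > 0 \<and> eps0 > 0 \<and>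
        (\<forall>eps. 0 < eps \<and> eps \<le> eps0 \<longrightarrow> (\<forall>i\<in>{1..M}. \<forall>j\<in>{1..M}. posTrans Q S i j \<longrightarrow>
          (\<forall>x\<in>S i. integrable (condT Q eps x (S j)) (\<lambda>s. s) \<and>
             (\<integral>\<^sup>+ s. ennreal ((s - (\<integral>u. u \<partial>condT Q eps x (S j)))\<^sup>2) \<partial>condT Q eps x (S j))
               \<le> ennreal (C * (tau i eps)\<^sup>2))))"
    and d_shape: "\<forall>f :: real \<Rightarrow> real. continuous_on {0..} f \<longrightarrow> bounded (f ` {0..}) \<longrightarrow>
        (\<forall>i\<in>{1..M}. \<forall>j1\<in>{1..M}. \<forall>j2\<in>{1..M}. posTrans Q S i j1 \<longrightarrow> posTrans Q S i j2 \<longrightarrow>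
          uniform_limit (S i \<times> S i)
            (\<lambda>eps (x1, x2). (\<integral>s. f (s / tau i eps) \<partial>condT Q eps x1 (S j1))
                             - (\<integral>s. f (s / tau i eps) \<partial>condT Q eps x2 (S j2)))
            (\<lambda>_. 0) (at_right 0))"
    and e_noatoms: "\<forall>i\<in>{1..M}. \<forall>j\<in>{1..M}. posTrans Q S i j \<longrightarrow>
        (\<forall>(xs :: nat \<Rightarrow> 'a) (es :: nat \<Rightarrow> real) (\<xi> :: real measure).
           (\<forall>n. xs n \<in> S i) \<longrightarrow> (\<forall>n. es n > 0) \<longrightarrow> decseq es \<longrightarrow> es \<longlonglongrightarrow> 0 \<longrightarrow>
           real_distribution \<xi> \<longrightarrow>
           weak_conv_m (\<lambda>n. distr (condT Q (es n) (xs n) (S j)) borel (\<lambda>s. s / tau i (es n))) \<xi> \<longrightarrow>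
           (\<forall>a. measure \<xi> {a} = 0))"
    and f_regular: "\<forall>(r::nat) (a::nat \<Rightarrow> nat) (b::nat \<Rightarrow> nat) (d::nat \<Rightarrow> nat) (c::nat) (c'::nat).
        (\<forall>k<r. a k \<in> {1..M} \<and> b k \<in> {1..M} \<and> d k \<in> {1..M} \<and> a k \<noteq> b k \<and> a k \<noteq> d k
               \<and> posTrans Q S (a k) (d k)) \<longrightarrow> c \<in> {1..M} \<longrightarrow> c' \<in> {1..M} \<longrightarrow>
        (\<exists>L::ereal. L \<ge> 0 \<and>
           ((\<lambda>eps. ereal ((\<Prod>k<r. Pij (a k) (b k) eps / Pij (a k) (d k) eps) * (tau c eps / tau c' eps)))
              \<longlongrightarrow> L) (at_right 0))"
    and M'_bounds: "1 < M'" "M' < M"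
    and ergodic: "ergodic_class (P0 Pij) M {1..M'}"
  shows
    "(\<forall>t :: real \<Rightarrow> real. (\<forall>eps>0. t eps > 0) \<longrightarrow>
        fastSet tau t M' \<noteq> {} \<longrightarrow> slowSet tau t M' \<noteq> {} \<longrightarrow>
        fastSet tau t M' \<union> slowSet tau t M' = {1..M'} \<longrightarrow>
        (\<forall>i\<in>fastSet tau t M'. \<exists>\<mu> :: nat \<Rightarrow> real.
           (\<forall>j. \<mu> j \<ge> 0) \<and> (\<forall>j. j \<notin> slowSet tau t M' \<longrightarrow> \<mu> j = 0) \<and>
           (\<Sum>j\<in>slowSet tau t M'. \<mu> j) = 1 \<and>
           (\<forall>j\<in>{1..M}. uniform_limit (S i)
              (\<lambda>eps x. semiMarkovProb Q eps x (t eps) (S j)) (\<lambda>_. \<mu> j) (at_right 0))))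
   \<and> (\<forall>t1 t2 :: real \<Rightarrow> real. (\<forall>eps>0. 0 < t1 eps \<and> t1 eps \<le> t2 eps) \<longrightarrow>
        fastSet tau t1 M' = fastSet tau t2 M' \<longrightarrow> slowSet tau t1 M' = slowSet tau t2 M' \<longrightarrow>
        fastSet tau t1 M' \<noteq> {} \<longrightarrow> slowSet tau t1 M' \<noteq> {} \<longrightarrow>
        fastSet tau t1 M' \<union> slowSet tau t1 M' = {1..M'} \<longrightarrow>
        (\<forall>i\<in>fastSet tau t1 M'. \<exists>\<mu> :: nat \<Rightarrow> real.
           (\<forall>j. \<mu> j \<ge> 0) \<and> (\<forall>j. j \<notin> slowSet tau t1 M' \<longrightarrow> \<mu> j = 0) \<and>
           (\<Sum>j\<in>slowSet tau t1 M'. \<mu> j) = 1 \<and>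
           (\<forall>j\<in>{1..M}. \<forall>e>0. \<forall>\<^sub>F eps in at_right 0.
              \<forall>t :: real \<Rightarrow> real. (\<forall>eps'>0. t1 eps' \<le> t eps' \<and> t eps' \<le> t2 eps') \<longrightarrow>
                (\<forall>x\<in>S i. \<bar>semiMarkovProb Q eps x (t eps) (S j) - \<mu> j\<bar> < e))))"
proof -
  interpret F: semi_markov_family Q S M Pij tau
  proof
    show "\<forall>\<^sub>F eps in at_right 0. \<forall>x\<in>S i. integrable (condT Q eps x (S j)) (\<lambda>s. s)"
      if ij: "i \<in> {1..M}" "j \<in> {1..M}" "posTrans Q S i j" for i j
    proof -
      obtain eps0 where "0 < eps0" and int: "\<And>eps x. 0 < eps \<Longrightarrow> eps \<le> eps0 \<Longrightarrow> x \<in> S i \<Longrightarrow>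
          integrable (condT Q eps x (S j)) (\<lambda>s. s)"
        using c_var ij by blast
      then show ?thesis by (intro eventually_at_rightI[of 0 eps0]) auto
    qed
    \<comment> \<open>The product in (f) is taken with one factor, from constant index sequences,
      and with \<open>i\<close> for both time indices.\<close>
    show "\<exists>L\<ge>0. ((\<lambda>eps. ereal (Pij i j eps / Pij i d eps * (tau i eps / tau i eps))) \<longlongrightarrow> L) (at_right 0)"
      if "i \<in> {1..M}" "j \<in> {1..M}" "d \<in> {1..M}" "i \<noteq> j" "i \<noteq> d" "posTrans Q S i d" for i j d
      using f_regular[rule_format, of 1 "\<lambda>_. i" "\<lambda>_. j" "\<lambda>_. d" i i] that by auto
    show "measure \<xi> {a} = 0"
      if "i \<in> {1..M}" "j \<in> {1..M}" "posTrans Q S i j" "\<And>n. xs n \<in> S i" "\<And>n. 0 < es n" "decseq es"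
        "es \<longlonglongrightarrow> 0" "real_distribution \<xi>"
        "weak_conv_m (\<lambda>n. distr (condT Q (es n) (xs n) (S j)) borel (\<lambda>s. s / tau i (es n))) \<xi>"
      for i j xs es \<xi> a
      using e_noatoms[rule_format, OF that] .
  qed (rule S_disj S_cover kernel[rule_format] times_nonneg[rule_format] S_meas[rule_format]
      a_noself[rule_format] a_dich[rule_format] a_asym[rule_format] a_zero[rule_format]
      a_sum[rule_format] a_conn[rule_format] b_mean[rule_format]; assumption)+
  have limit: "\<exists>\<mu>. (\<forall>j. 0 \<le> \<mu> j) \<and> (\<forall>j. j \<notin> slowSet tau t1 M' \<longrightarrow> \<mu> j = 0) \<and>
      (\<Sum>j\<in>slowSet tau t1 M'. \<mu> j) = 1 \<and>
      (\<forall>j\<in>{1..M}. \<forall>e>0. \<forall>\<^sub>F eps in at_right 0. \<forall>x\<in>S i. \<forall>u. t1 eps \<le> u \<longrightarrow> u \<le> t2 eps \<longrightarrow>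
        \<bar>semiMarkovProb Q eps x u (S j) - \<mu> j\<bar> < e)"
    if t1: "\<And>eps. 0 < eps \<Longrightarrow> 0 < t1 eps" and same: "slowSet tau t1 M' = slowSet tau t2 M'"
      and ne: "slowSet tau t1 M' \<noteq> {}" and cover: "fastSet tau t1 M' \<union> slowSet tau t1 M' = {1..M'}"
      and i: "i \<in> fastSet tau t1 M'" for t1 t2 i
  proof (rule F.metastable_limit[OF ergodic])
    show "llt (tau k) t1" if "k \<in> {1..M'} - slowSet tau t1 M'" for k
    proof -
      have "k \<in> fastSet tau t1 M'" using cover that by blast
      then show ?thesis by (simp add: fastSet_def)
    qed
    \<comment> \<open>Equality of the slow sets carries slowness from the lower to the upper end of
      the window.\<close>
    show "llt t2 (tau k)" if "k \<in> slowSet tau t1 M'" for k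
      using that unfolding same by (simp add: slowSet_def)
  qed (use t1 ne cover i in blast)+
  show ?thesis
  proof (intro conjI allI impI ballI)
    fix t :: "real \<Rightarrow> real" and i
    assume t: "\<forall>eps>0. 0 < t eps" and "fastSet tau t M' \<noteq> {}" and ne: "slowSet tau t M' \<noteq> {}"
      and cover: "fastSet tau t M' \<union> slowSet tau t M' = {1..M'}" and i: "i \<in> fastSet tau t M'"
    \<comment> \<open>A single time scale is the degenerate window with both ends equal to
      \<open>t\<close>.\<close>
    obtain \<mu> where \<mu>: "\<forall>j. 0 \<le> \<mu> j" "\<forall>j. j \<notin> slowSet tau t M' \<longrightarrow> \<mu> j = 0"
      "(\<Sum>j\<in>slowSet tau t M'. \<mu> j) = 1"
      and lim: "\<forall>j\<in>{1..M}. \<forall>e>0. \<forall>\<^sub>F eps in at_right 0. \<forall>x\<in>S i. \<forall>u. t eps \<le> u \<longrightarrow> u \<le> t eps \<longrightarrow>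
        \<bar>semiMarkovProb Q eps x u (S j) - \<mu> j\<bar> < e"
      using limit[OF t[rule_format] refl ne cover i] by blast
    have "uniform_limit (S i) (\<lambda>eps x. semiMarkovProb Q eps x (t eps) (S j)) (\<lambda>_. \<mu> j) (at_right 0)"
      if "j \<in> {1..M}" for j
    proof (rule uniform_limitI)
      fix e :: real assume "0 < e"
      with lim that have "\<forall>\<^sub>F eps in at_right 0. \<forall>x\<in>S i. \<forall>u. t eps \<le> u \<longrightarrow> u \<le> t eps \<longrightarrow>
        \<bar>semiMarkovProb Q eps x u (S j) - \<mu> j\<bar> < e" by blast
      then show "\<forall>\<^sub>F eps in at_right 0. \<forall>x\<in>S i. dist (semiMarkovProb Q eps x (t eps) (S j)) (\<mu> j) < e"
        by eventually_elim (simp add: dist_real_def)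
    qed
    with \<mu> show "\<exists>\<mu>. (\<forall>j. 0 \<le> \<mu> j) \<and> (\<forall>j. j \<notin> slowSet tau t M' \<longrightarrow> \<mu> j = 0) \<and>
        (\<Sum>j\<in>slowSet tau t M'. \<mu> j) = 1 \<and>
        (\<forall>j\<in>{1..M}. uniform_limit (S i) (\<lambda>eps x. semiMarkovProb Q eps x (t eps) (S j)) (\<lambda>_. \<mu> j) (at_right 0))"
      by blast
  next
    fix t1 t2 :: "real \<Rightarrow> real" and i
    assume t: "\<forall>eps>0. 0 < t1 eps \<and> t1 eps \<le> t2 eps"
      and same: "slowSet tau t1 M' = slowSet tau t2 M'"
      and ne: "slowSet tau t1 M' \<noteq> {}" and cover: "fastSet tau t1 M' \<union> slowSet tau t1 M' = {1..M'}"
      and i: "i \<in> fastSet tau t1 M'"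
    have "\<And>eps. 0 < eps \<Longrightarrow> 0 < t1 eps" using t by blast
    from limit[OF this same ne cover i]
    obtain \<mu> where \<mu>: "\<forall>j. 0 \<le> \<mu> j" "\<forall>j. j \<notin> slowSet tau t1 M' \<longrightarrow> \<mu> j = 0"
      "(\<Sum>j\<in>slowSet tau t1 M'. \<mu> j) = 1"
      and lim: "\<forall>j\<in>{1..M}. \<forall>e>0. \<forall>\<^sub>F eps in at_right 0. \<forall>x\<in>S i. \<forall>u. t1 eps \<le> u \<longrightarrow> u \<le> t2 eps \<longrightarrow>
        \<bar>semiMarkovProb Q eps x u (S j) - \<mu> j\<bar> < e"
      by blast
    \<comment> \<open>At a given \<open>eps\<close> a time scale enters only through the number
      \<open>t eps\<close>, so uniformity over the numbers \<open>u\<close> covers all functions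
      \<open>t\<close> at once.\<close>
    have "\<forall>\<^sub>F eps in at_right 0. \<forall>t. (\<forall>eps'>0. t1 eps' \<le> t eps' \<and> t eps' \<le> t2 eps') \<longrightarrow>
        (\<forall>x\<in>S i. \<bar>semiMarkovProb Q eps x (t eps) (S j) - \<mu> j\<bar> < e)" if "j \<in> {1..M}" "0 < e" for j e
    proof -
      from lim that have "\<forall>\<^sub>F eps in at_right 0. \<forall>x\<in>S i. \<forall>u. t1 eps \<le> u \<longrightarrow> u \<le> t2 eps \<longrightarrow>
        \<bar>semiMarkovProb Q eps x u (S j) - \<mu> j\<bar> < e" by blast
      with F.eventually_at_right_0_pos show ?thesis by eventually_elim blast
    qed
    with \<mu> show "\<exists>\<mu>. (\<forall>j. 0 \<le> \<mu> j) \<and> (\<forall>j. j \<notin> slowSet tau t1 M' \<longrightarrow> \<mu> j = 0) \<and>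
        (\<Sum>j\<in>slowSet tau t1 M'. \<mu> j) = 1 \<and>
        (\<forall>j\<in>{1..M}. \<forall>e>0. \<forall>\<^sub>F eps in at_right 0. \<forall>t. (\<forall>eps'>0. t1 eps' \<le> t eps' \<and> t eps' \<le> t2 eps') \<longrightarrow>
          (\<forall>x\<in>S i. \<bar>semiMarkovProb Q eps x (t eps) (S j) - \<mu> j\<bar> < e))"
      by blast
  qed
qed

end
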